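(* Let $(X^*,z^* )$ be a P-stationary point of problem (P) with constant $\alpha$, $0<\alpha<\alpha_*$. Assume that the matrices $A_i$, $i\in\mathcal{T}_*$, are linearly independent, that there are $L_*>0$ and $\delta_0^*>0$ with $\|\nabla^2f(X^1)-\nabla^2f(X^2)\|_F\le L_*\|X^1-X^2\|_F$ for all $X^1,X^2\in B(X^*,\delta_0^* )$, and that the second-order sufficient condition of problem (P) holds at $X^*$. Let $c_*,C_*,\delta_2^*$ be the constants defined in the context. Let $\{(X^k,z^k)\}$ be the sequence generated by Algorithm 1 (described in the context) with $0\le\gamma_{-1}\le\frac{c_*}2$. If the initial point satisfies $(X^0,z^0)\in B((X^*,z^* ),\delta^* )$, where $$\delta^*:=\min\Big\{\delta_2^*,\ \frac{c_*}{2(L_*+2\rho C_* )}\Big\},$$ then the following results hold. (i) The sequence $\{D^k\}_{k=1}^\infty$ is well defined and $\lim_{k\to\infty}(D_X^k,D^k_{\mathcal{T}_k},D^k_{\bar{\mathcal{T}}_k})=0$. (ii) The whole sequence $\{(X^k,z^k)\}$ converges to $(X^*,z^* )$ quadratically, namely $$\|X^{k+1}-X^*\|_F+\|z^{k+1}-z^*\|\le\frac{L_*+2\rho C_*}{c_*}\big(\|X^k-X^*\|_F^2+\|z^k-z^*\|^2\big).$$ (iii) The halting condition satisfies $$\|\Psi(X^{k+1},z^{k+1};\mathcal{T}_{k+1})\|_F\le\frac{C_*(L_*+2\rho C_* )}{c_*^3}\|\Psi(X^k,z^k;\mathcal{T}_k)\|_F^2,$$ and Algorithm 1 achieves $\|\Psi(X^k,z^k;\mathcal{T}_k)\|_F<\epsilon$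 for a given tolerance $\epsilon>0$ when $$k\ge\log_2\Big(2\sqrt{\tfrac{(L_*+2\rho C_* )C_*^3}{c_*^3}}\,\big(\|X^0-X^*\|_F+\|z^0-z^*\|\big)\Big)-\log_2\sqrt\epsilon.$$
   Context: Setting. $\mathbb{R}^{m\times p}$ carries $\langle X,Y\rangle=\mathrm{tr}(X^TY)$ and the Frobenius norm $\|\cdot\|_F$. $f:\mathbb{R}^{m\times p}\to\mathbb{R}$ is twice continuously differentiable, $\lambda>0$, $A_1,\dots,A_n\in\mathbb{R}^{m\times p}$, $F(X)=(F_i(X))_{i=1}^n$ with $F_i(X)=1+\langle A_i,X\rangle$; $\|y_+\|_0$ is the number of strictly positive entries of $y\in\mathbb{R}^n$; $\varphi(X)=\|F(X)_+\|_0$. Problem (P): $\min_Xf(X)+\lambda\varphi(X)$. $[\nabla^2f(X)V]_{ij}=\sum_{k,l}\frac{\partial^2f(X)}{\partial X_{ij}\partial X_{kl}}V_{kl}$ and $\|\nabla^2f(X)\|_F$ is the square root of the sum of squares of all second partial derivatives. $B(X^*,\delta)$ is the open Frobenius ball, and $B((X^*,z^* ),\delta)$ is the open ball in $\mathbb{R}^{m\times p}\times\mathbb{R}^n$ for the norm $(\|X\|_F^2+\|z\|^2)^{1/2}$. For $\mathcal{T}\subseteq\{1,\dots,n\}$: $\bar{\mathcal{T}}$ is its complement, $z_{\mathcal{T}}$ the subvector, $A_{\mathcal{T}}^Tz_{\mathcal{T}}=\sum_{i\in\mathcal{T}}z_iA_i$, $A_{\mathcal{T}}V=(\langle A_i,V\rangle)_{i\in\mathcal{T}}$;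 $A^Tz=\sum_{i=1}^n z_iA_i$. P-stationarity. $\mathrm{prox}_{\beta h}(z)=\operatorname{argmin}_uh(u)+\frac1{2\beta}\|u-z\|^2$. $(X^*,z^* )$ is P-stationary with constant $\alpha>0$ if $\nabla f(X^* )+A^Tz^*=0$ and $F(X^* )\in\mathrm{prox}_{\alpha\lambda\|(\cdot)_+\|_0}(F(X^* )+\alpha z^* )$. $\alpha_*=\min\{\alpha_1,\alpha_2\}$ with $\alpha_1=\min\{F_i(X^* )^2/(2\lambda):F_i(X^* )>0\}$ and $\alpha_2=\min\{2\lambda/(z_i^* )^2:z_i^*>0\}$ (each $+\infty$ if no such $i$). $\mathcal{T}_*=\{i:F_i(X^* )=0\}$. Second-order sufficient condition: $0\in\partial(f+\lambda\varphi)(X^* )$ and there is $z\in\Lambda(X^*,-\nabla f(X^* ))$ with $\langle D,\nabla^2f(X^* )D\rangle>0$ for all nonzero $D\in\mathbb{R}^{m\times p}$ satisfying $z_i\langle D,A_i\rangle=0$, $\langle D,A_i\rangle\le0$, $z_i\ge 0$ for all $i\in\mathcal{T}_*$. Here $\partial$ is the limiting subdifferential, and $\Lambda(X^*,V)=\{z\in\partial g(F(X^* )):A^Tz=V\}$ with $g(y)=\|y_+\|_0$. Stationary equation and index sets. $$\Psi(X,z;\mathcal{T})=\begin{pmatrix}\nabla f(X)+A_{\mathcal{T}}^Tz_{\mathcal{T}} \\ F(X)_{\mathcal{T}} \\ z_{\bar{\mathcal{T}}}\end{pmatrix},\quad\|\Psi(X,z;\mathcal{T})\|_F=\big(\|\nabla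 f(X)+A_{\mathcal{T}}^Tz_{\mathcal{T}}\|_F^2+\|(F(X)_{\mathcal{T}},z_{\bar{\mathcal{T}}})\|^2\big)^{1/2}.$$ For $(X,z)$ let $\mathcal{T}_o=\{i:F_i(X)=0,\ \alpha z_i\in\{0,\sqrt{2\alpha\lambda}\}\}$, $\mathcal{T}_1=\{i:F_i(X)+\alpha z_i\in(0,\sqrt{2\alpha\lambda})\}$; the index set associated with $(X,z)$ is $\mathcal{T}=\mathcal{T}_o\cup\mathcal{T}_1$. $\mathcal{T}_k$ denotes the index set associated with $(X^k,z^k)$. Algorithm 1 (parameters $\alpha,\rho,\lambda>0$, $\tau\in(0,1)$, starting data $(X^0,z^0)$, $\gamma_{-1}$). For $k=0,1,\dots$, while $\|\Psi(X^k,z^k;\mathcal{T}_k)\|_F>0$: set $\gamma_k=\min\{\tau\gamma_{k-1},\ \rho\|\Psi(X^k,z^k;\mathcal{T}_k)\|_F\}$; compute the direction $D^k=(D_X^k,D^k_{\mathcal{T}_k},D^k_{\bar{\mathcal{T}}_k})$ from $$\nabla^2f(X^k)D_X^k+A_{\mathcal{T}_k}^TD^k_{\mathcal{T}_k}=-(\nabla f(X^k)+A^T_{\mathcal{T}_k}z^k_{\mathcal{T}_k}),\quad A_{\mathcal{T}_k}D_X^k-\gamma_kD^k_{\mathcal{T}_k}=-F(X^k)_{\mathcal{T}_k},\quad D^k_{\bar{\mathcal{T}}_k}=-z^k_{\bar{\mathcal{T}}_k};$$ set $(X^{k+1},z^{k+1})=(X^k,z^k)+D^k$ and update $\mathcal{T}_{k+1}$.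 The algorithm uses the same $\alpha$ as the P-stationary point. Constants. Let $\nabla_{\rm vec}^2f(X)=\frac{\partial^2f(X)}{\partial\mathrm{vec}(X)\partial\mathrm{vec}(X)^T}\in\mathbb{R}^{mp\times mp}$ (vec stacks columns), let $B_{\mathcal{T}}\in\mathbb{R}^{|\mathcal{T}|\times mp}$ have rows $\mathrm{vec}(A_i)^T$, $i\in\mathcal{T}$, and $$H(\mathcal{T})=\begin{pmatrix}\nabla_{\rm vec}^2f(X^* )&B_{\mathcal{T}}^T \\ B_{\mathcal{T}}&0\end{pmatrix}.$$ With $\sigma_{\max},\sigma_{\min}$ the largest and smallest singular values, $$C_*=2\max\{1,\sigma_{\max}(H(\mathcal{T}_* ))\},\quad c_*=\tfrac12\min\{1,\min_{\mathcal{T}\subseteq\mathcal{T}_*}\sigma_{\min}(H(\mathcal{T}))\},\quad\delta_2^*=\min\{\delta_1^*,\tfrac{c_*}{2L_*}\},$$ where $\delta_1^*>0$ is a radius such that for every $(X,z)\in B((X^*,z^* ),\delta_1^* )$ with associated index set $\mathcal{T}$ one has $\Psi(X^*,z^*;\mathcal{T})=0$ and $\mathcal{T}\subseteq\mathcal{T}_*$.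
   Formalization: The formal theorem adds the assumption δ* ≤ δ_0* (otherwise the Lipschitz bound need not reach the starting point and the claim can fail), and states the iteration bound in (iii) only for k ≥ 1, since for k = 0 it is false. *)

theory Defs
  imports "HOL-Analysis.Analysis"
begin

(* The space of m x p matrices is real^'p^'m (row index 'm outermost); its library inner
   product is tr (X^T Y) and its library norm is the Frobenius norm. The library norm of a
   pair is sqrt (norm X ^ 2 + norm z ^ 2), and the norm of real^'p^'m^'p^'m is the square
   root of the sum of squares of all entries. *)

definition partial_deriv ::
    "(real^'p^'m \<Rightarrow> real) \<Rightarrow> 'm \<Rightarrow> 'p \<Rightarrow> real^'p^'m \<Rightarrow> real" where
  "partial_deriv f i j X = deriv (\<lambda>t. f (X + t *\<^sub>R axis i (axis j 1))) 0"

definition grad :: "(real^'p^'m \<Rightarrow> real) \<Rightarrow> real^'p^'m \<Rightarrow> real^'p^'m" where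
  "grad f X = (\<chi> i j. partial_deriv f i j X)"

definition hess :: "(real^'p^'m \<Rightarrow> real) \<Rightarrow> real^'p^'m \<Rightarrow> real^'p^'m^'p^'m" where
  "hess f X = (\<chi> i j k l. partial_deriv (partial_deriv f k l) i j X)"

definition hess_apply :: "(real^'p^'m \<Rightarrow> real) \<Rightarrow> real^'p^'m \<Rightarrow> real^'p^'m \<Rightarrow> real^'p^'m" where
  "hess_apply f X V = (\<chi> i j. \<Sum>k\<in>UNIV. \<Sum>l\<in>UNIV. hess f X $ i $ j $ k $ l * V $ k $ l)"

definition twice_cont_diff :: "(real^'p^'m \<Rightarrow> real) \<Rightarrow> bool" where
  "twice_cont_diff f \<longleftrightarrow>
     (\<forall>X. f differentiable (at X)) \<and>
     (\<forall>X. grad f differentiable (at X)) \<and>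
     continuous_on UNIV (hess f)"

definition frechet_subdiff :: "('a::real_inner \<Rightarrow> real) \<Rightarrow> 'a \<Rightarrow> 'a set" where
  "frechet_subdiff h x =
     {v. Liminf (at x) (\<lambda>y. ereal ((h y - h x - v \<bullet> (y - x)) / norm (y - x))) \<ge> 0}"

definition limiting_subdiff :: "('a::real_inner \<Rightarrow> real) \<Rightarrow> 'a \<Rightarrow> 'a set" where
  "limiting_subdiff h x =
     {v. \<exists>xs vs. xs \<longlonglongrightarrow> x \<and> (\<lambda>k. h (xs k)) \<longlonglongrightarrow> h x \<and>
                 (\<forall>k. vs k \<in> frechet_subdiff h (xs k)) \<and> vs \<longlonglongrightarrow> v}"

definition prox :: "real \<Rightarrow> ('a::real_normed_vector \<Rightarrow> real) \<Rightarrow> 'a \<Rightarrow> 'a set" where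
  "prox \<beta> h z =
     {u. is_arg_min (\<lambda>u. h u + 1 / (2 * \<beta>) * (norm (u - z))\<^sup>2) (\<lambda>_. True) u}"

definition pos_count :: "real^'n \<Rightarrow> real" where
  "pos_count y = real (card {i. y $ i > 0})"

definition Fmap :: "('n \<Rightarrow> real^'p^'m) \<Rightarrow> real^'p^'m \<Rightarrow> real^'n" where
  "Fmap A X = (\<chi> i. 1 + A i \<bullet> X)"

definition phi :: "('n::finite \<Rightarrow> real^'p^'m) \<Rightarrow> real^'p^'m \<Rightarrow> real" where
  "phi A X = pos_count (Fmap A X)"

definition adjoint_on :: "('n::finite \<Rightarrow> real^'p^'m) \<Rightarrow> 'n set \<Rightarrow> real^'n \<Rightarrow> real^'p^'m" where
  "adjoint_on A T z = (\<Sum>i\<in>T. (z $ i) *\<^sub>R A i)"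

definition P_stationary ::
    "(real^'p^'m \<Rightarrow> real) \<Rightarrow> real \<Rightarrow> ('n::finite \<Rightarrow> real^'p^'m) \<Rightarrow> real \<Rightarrow>
     real^'p^'m \<Rightarrow> real^'n \<Rightarrow> bool" where
  "P_stationary f lam A \<alpha> X z \<longleftrightarrow>
     grad f X + adjoint_on A UNIV z = 0 \<and>
     Fmap A X \<in> prox \<alpha> (\<lambda>u. lam * pos_count u) (Fmap A X + \<alpha> *\<^sub>R z)"

(* In ereal, the infimum over the empty index set is infinity. *)
definition alpha_star ::
    "real \<Rightarrow> ('n::finite \<Rightarrow> real^'p^'m) \<Rightarrow> real^'p^'m \<Rightarrow> real^'n \<Rightarrow> ereal" where
  "alpha_star lam A X z =
     min (INF i\<in>{i. Fmap A X $ i > 0}. ereal ((Fmap A X $ i)\<^sup>2 / (2 * lam)))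
         (INF i\<in>{i. z $ i > 0}. ereal (2 * lam / (z $ i)\<^sup>2))"

definition active_set :: "('n::finite \<Rightarrow> real^'p^'m) \<Rightarrow> real^'p^'m \<Rightarrow> 'n set" where
  "active_set A X = {i. Fmap A X $ i = 0}"

definition multipliers ::
    "('n::finite \<Rightarrow> real^'p^'m) \<Rightarrow> real^'p^'m \<Rightarrow> real^'p^'m \<Rightarrow> (real^'n) set" where
  "multipliers A X V = {z \<in> limiting_subdiff pos_count (Fmap A X). adjoint_on A UNIV z = V}"

definition second_order_sufficient ::
    "(real^'p^'m \<Rightarrow> real) \<Rightarrow> real \<Rightarrow> ('n::finite \<Rightarrow> real^'p^'m) \<Rightarrow> real^'p^'m \<Rightarrow> bool" where
  "second_order_sufficient f lam A X \<longleftrightarrow>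
     0 \<in> limiting_subdiff (\<lambda>Y. f Y + lam * phi A Y) X \<and>
     (\<exists>z \<in> multipliers A X (- grad f X).
        \<forall>D. D \<noteq> 0 \<and>
            (\<forall>i\<in>active_set A X. z $ i * (D \<bullet> A i) = 0 \<and> D \<bullet> A i \<le> 0 \<and> z $ i \<ge> 0)
            \<longrightarrow> D \<bullet> hess_apply f X D > 0)"

definition index_set ::
    "real \<Rightarrow> real \<Rightarrow> ('n::finite \<Rightarrow> real^'p^'m) \<Rightarrow> real^'p^'m \<Rightarrow> real^'n \<Rightarrow> 'n set" where
  "index_set \<alpha> lam A X z =
     {i. Fmap A X $ i = 0 \<and> \<alpha> * z $ i \<in> {0, sqrt (2 * \<alpha> * lam)}} \<union>
     {i. Fmap A X $ i + \<alpha> * z $ i \<in> {0<..<sqrt (2 * \<alpha> * lam)}}"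

(* The blocks F(X)_T and z_(-T) are indexed by complementary sets; they are stored together
   in one vector of real^'n, which leaves the norm unchanged. *)
definition Psi ::
    "(real^'p^'m \<Rightarrow> real) \<Rightarrow> ('n::finite \<Rightarrow> real^'p^'m) \<Rightarrow> real^'p^'m \<Rightarrow> real^'n \<Rightarrow> 'n set \<Rightarrow>
     (real^'p^'m) \<times> (real^'n)" where
  "Psi f A X z T =
     (grad f X + adjoint_on A T z, \<chi> i. if i \<in> T then Fmap A X $ i else z $ i)"

(* A direction d = (D_X, D_z) stores the blocks D_T and D_(-T) as the components of D_z. *)
definition newton_system ::
    "(real^'p^'m \<Rightarrow> real) \<Rightarrow> ('n::finite \<Rightarrow> real^'p^'m) \<Rightarrow> real^'p^'m \<Rightarrow> real^'n \<Rightarrow> 'n set \<Rightarrow>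
     real \<Rightarrow> (real^'p^'m) \<times> (real^'n) \<Rightarrow> bool" where
  "newton_system f A X z T \<gamma> d \<longleftrightarrow>
     hess_apply f X (fst d) + adjoint_on A T (snd d) = - (grad f X + adjoint_on A T z) \<and>
     (\<forall>i\<in>T. A i \<bullet> fst d - \<gamma> * snd d $ i = - (Fmap A X $ i)) \<and>
     (\<forall>i\<in>-T. snd d $ i = - (z $ i))"

(* g is gamma_(-1); psi k stands for the norm of Psi at the k-th iterate. *)
primrec reg_param :: "real \<Rightarrow> real \<Rightarrow> real \<Rightarrow> (nat \<Rightarrow> real) \<Rightarrow> nat \<Rightarrow> real" where
  "reg_param \<tau> \<rho> g psi 0 = min (\<tau> * g) (\<rho> * psi 0)"
| "reg_param \<tau> \<rho> g psi (Suc k) = min (\<tau> * reg_param \<tau> \<rho> g psi k) (\<rho> * psi (Suc k))"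

definition Psi_norm ::
    "(real^'p^'m \<Rightarrow> real) \<Rightarrow> real \<Rightarrow> ('n::finite \<Rightarrow> real^'p^'m) \<Rightarrow> real \<Rightarrow>
     (nat \<Rightarrow> real^'p^'m) \<Rightarrow> (nat \<Rightarrow> real^'n) \<Rightarrow> nat \<Rightarrow> real" where
  "Psi_norm f lam A \<alpha> X z k = norm (Psi f A (X k) (z k) (index_set \<alpha> lam A (X k) (z k)))"

definition newton_step_at ::
    "(real^'p^'m \<Rightarrow> real) \<Rightarrow> real \<Rightarrow> ('n::finite \<Rightarrow> real^'p^'m) \<Rightarrow> real \<Rightarrow> real \<Rightarrow> real \<Rightarrow> real \<Rightarrow>
     (nat \<Rightarrow> real^'p^'m) \<Rightarrow> (nat \<Rightarrow> real^'n) \<Rightarrow> nat \<Rightarrow> (real^'p^'m) \<times> (real^'n) \<Rightarrow> bool" where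
  "newton_step_at f lam A \<alpha> \<rho> \<tau> g X z k d \<longleftrightarrow>
     newton_system f A (X k) (z k) (index_set \<alpha> lam A (X k) (z k))
       (reg_param \<tau> \<rho> g (Psi_norm f lam A \<alpha> X z) k) d"

(* If the loop stops at iterate k, the sequence is continued by the constant value, with zero
   directions, so that a run is always an infinite sequence. *)
definition algorithm_run ::
    "(real^'p^'m \<Rightarrow> real) \<Rightarrow> real \<Rightarrow> ('n::finite \<Rightarrow> real^'p^'m) \<Rightarrow> real \<Rightarrow> real \<Rightarrow> real \<Rightarrow> real \<Rightarrow>
     real^'p^'m \<Rightarrow> real^'n \<Rightarrow>
     (nat \<Rightarrow> real^'p^'m) \<Rightarrow> (nat \<Rightarrow> real^'n) \<Rightarrow> (nat \<Rightarrow> (real^'p^'m) \<times> (real^'n)) \<Rightarrow> bool" where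
  "algorithm_run f lam A \<alpha> \<rho> \<tau> g X0 z0 X z D \<longleftrightarrow>
     X 0 = X0 \<and> z 0 = z0 \<and>
     (\<forall>k. (if Psi_norm f lam A \<alpha> X z k > 0
           then newton_step_at f lam A \<alpha> \<rho> \<tau> g X z k (D k)
           else D k = 0) \<and>
          X (Suc k) = X k + fst (D k) \<and> z (Suc k) = z k + snd (D k))"

(* Square matrices whose rows and columns are indexed by a finite set I. *)
definition eigenvalue_on :: "'k set \<Rightarrow> ('k \<Rightarrow> 'k \<Rightarrow> real) \<Rightarrow> real \<Rightarrow> bool" where
  "eigenvalue_on I M \<mu> \<longleftrightarrow>
     (\<exists>v. (\<exists>i\<in>I. v i \<noteq> 0) \<and> (\<forall>i\<in>I. (\<Sum>j\<in>I. M i j * v j) = \<mu> * v i))"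

definition singular_values :: "'k set \<Rightarrow> ('k \<Rightarrow> 'k \<Rightarrow> real) \<Rightarrow> real set" where
  "singular_values I M = {sqrt \<mu> |\<mu>. eigenvalue_on I (\<lambda>i j. \<Sum>k\<in>I. M k i * M k j) \<mu>}"

definition sigma_max :: "'k set \<Rightarrow> ('k \<Rightarrow> 'k \<Rightarrow> real) \<Rightarrow> real" where
  "sigma_max I M = Max (singular_values I M)"

definition sigma_min :: "'k set \<Rightarrow> ('k \<Rightarrow> 'k \<Rightarrow> real) \<Rightarrow> real" where
  "sigma_min I M = Min (singular_values I M)"

(* H(T) has rows and columns indexed by UNIV <+> T: the entry (i,j) of vec X carries the index
   Inl (i,j), the row of B_T belonging to s carries the index Inr s. The order in which vec
   lists the entries does not affect singular values. *)
fun H_entry ::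
    "(real^'p^'m \<Rightarrow> real) \<Rightarrow> ('n \<Rightarrow> real^'p^'m) \<Rightarrow> real^'p^'m \<Rightarrow>
     ('m \<times> 'p) + 'n \<Rightarrow> ('m \<times> 'p) + 'n \<Rightarrow> real" where
  "H_entry f A X (Inl (i, j)) (Inl (k, l)) = hess f X $ i $ j $ k $ l"
| "H_entry f A X (Inl (i, j)) (Inr s) = A s $ i $ j"
| "H_entry f A X (Inr s) (Inl (k, l)) = A s $ k $ l"
| "H_entry f A X (Inr s) (Inr t) = 0"

definition C_star :: "(real^'p^'m \<Rightarrow> real) \<Rightarrow> ('n::finite \<Rightarrow> real^'p^'m) \<Rightarrow> real^'p^'m \<Rightarrow> real" where
  "C_star f A X = 2 * max 1 (sigma_max (UNIV <+> active_set A X) (H_entry f A X))"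

definition c_star :: "(real^'p^'m \<Rightarrow> real) \<Rightarrow> ('n::finite \<Rightarrow> real^'p^'m) \<Rightarrow> real^'p^'m \<Rightarrow> real" where
  "c_star f A X =
     1 / 2 * min 1 (Min {sigma_min (UNIV <+> T) (H_entry f A X) |T. T \<subseteq> active_set A X})"

end

theory Submission
  imports Defs
begin

text \<open>
  Write \<open>w = (X, z)\<close>, \<open>e = norm (w - w*)\<close> and \<open>K = L + 2 \<rho> C\<close>. The iteration is a semismooth
  Newton method: near \<open>w*\<close> every index set \<open>T\<close> that can occur is contained in the active set and
  satisfies \<open>\<Psi>(w*; T) = 0\<close>. So, although \<open>T\<close> may change from step to step, each step is a
  regularised Newton step for a smooth equation that has \<open>w*\<close> as a root, and it is enough to
  estimate one step uniformly in \<open>T\<close>.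

  The derivative of \<open>\<Psi>(\<cdot>; T)\<close> at \<open>w*\<close> is \<open>newton_op\<close> with regularisation 0. It is the direct sum
  of \<open>H(T)\<close> and an identity block, so that the singular values of \<open>H(T)\<close> give
  \<open>2 c norm v \<le> norm (J v) \<le> C / 2 norm v\<close> for it (\<open>newton_op_lower_bound\<close>,
  \<open>newton_op_upper_bound\<close>). The initial ball is nonempty, which forces \<open>c > 0\<close>.
  Replacing \<open>X*\<close> by \<open>X\<close> and switching on \<open>\<gamma> \<le> c / 2\<close> perturbs this operator by at
  most \<open>L e + \<gamma> \<le> c\<close>, whence the Newton operator \<open>G\<close> satisfies \<open>c norm v \<le> norm (G v)\<close>: the Newton
  system has exactly one solution (\<open>newton_system_ex1\<close>).

  The Lipschitz Hessian gives the Taylor estimate \<open>grad_linearization_bound\<close> with constant \<open>L / 2\<close>.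
  Used at \<open>X*\<close> it yields \<open>c e \<le> norm \<Psi> \<le> C e\<close> (\<open>Psi_bounds\<close>). Used at \<open>X\<close> it shows that
  \<open>G (w\<^sup>+ - w*)\<close> has norm at most \<open>L / 2 e\<^sup>2 + \<gamma> e\<close>, and \<open>\<gamma> \<le> \<rho> norm \<Psi> \<le> \<rho> C e\<close>, so
  \<open>e\<^sup>+ \<le> K / (2 c) e\<^sup>2\<close> (\<open>newton_step_error\<close>). As \<open>K e \<le> c / 2\<close> in the ball, also \<open>e\<^sup>+ \<le> e / 4\<close>, and
  the iterates never leave it. Every claim follows from these estimates: the residual bound from
  \<open>norm \<Psi>\<^sup>+ \<le> C e\<^sup>+\<close> and \<open>e \<le> norm \<Psi> / c\<close>, the iteration count from
  \<open>norm \<Psi>\<^sub>k \<le> C K / (2 c) (e\<^sub>0 / 4^(k-1))\<^sup>2\<close>.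
\<close>

section \<open>Symmetry of second derivatives\<close>

text \<open>The mean value theorem in the direction \<open>u\<close> turns the second difference into a first
  difference of the gradient along \<open>v\<close>, which the derivative \<open>G\<close> of the gradient controls.\<close>

lemma second_difference_approx:
  fixes f :: "'a::real_inner \<Rightarrow> real"
  assumes f: "\<And>y. (f has_derivative (\<lambda>h. g y \<bullet> h)) (at y)"
    and g: "(g has_derivative G) (at x)" and e: "e > 0"
  shows "\<exists>d>0. \<forall>t. 0 < t \<and> t < d \<longrightarrow>
    \<bar>f (x + t *\<^sub>R u + t *\<^sub>R v) - f (x + t *\<^sub>R u) - f (x + t *\<^sub>R v) + f x - t^2 * (G v \<bullet> u)\<bar> \<le> e * t^2"
proof -
  define M where "M = 2 * (norm u + norm v) * norm u + 1"
  have M: "M > 0" unfolding M_def by (smt (verit) mult_nonneg_nonneg norm_ge_zero)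
  define e' where "e' = e / M"
  have e': "e' > 0" using e M by (simp add: e'_def)
  interpret G: bounded_linear G using g by (rule has_derivative_bounded_linear)
  obtain d0 where d0: "d0 > 0" and
    rem: "\<And>y. norm (y - x) < d0 \<Longrightarrow> norm (g y - g x - G (y - x)) \<le> e' * norm (y - x)"
    using g e' unfolding has_derivative_at_alt by blast
  define d where "d = d0 / (norm u + norm v + 1)"
  have nn: "norm u + norm v + 1 > 0" by (smt (verit) norm_ge_zero)
  have d: "d > 0" using d0 nn by (simp add: d_def)
  show ?thesis
  proof (intro exI conjI allI impI)
    show "d > 0" by (rule d)
    fix t :: real assume "0 < t \<and> t < d"
    then have t: "0 < t" "t < d" by auto
    define \<phi> where "\<phi> s = f (x + t *\<^sub>R v + s *\<^sub>R u) - f (x + s *\<^sub>R u)" for s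
    define \<phi>' where "\<phi>' s = (g (x + t *\<^sub>R v + s *\<^sub>R u) - g (x + s *\<^sub>R u)) \<bullet> u" for s
    have der: "DERIV (\<lambda>s. f (y + s *\<^sub>R u)) s :> g (y + s *\<^sub>R u) \<bullet> u" for y s
    proof -
      have "((\<lambda>s. y + s *\<^sub>R u) has_derivative (\<lambda>h. h *\<^sub>R u)) (at s)"
        by (auto intro!: derivative_eq_intros)
      from has_derivative_compose[OF this f] show ?thesis
        by (simp add: has_field_derivative_def mult_commute_abs)
    qed
    have "DERIV \<phi> s :> \<phi>' s" for s
      unfolding \<phi>_def \<phi>'_def using DERIV_diff[OF der[of "x + t *\<^sub>R v" s] der[of x s]]
      by (simp add: inner_diff_left)
    then obtain s where s: "0 < s" "s < t" and mvt: "\<phi> t - \<phi> 0 = (t - 0) * \<phi>' s"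
      using MVT2[of 0 t \<phi> \<phi>'] t by blast
    define r where "r h = g (x + h) - g x - G h" for h
    have small: "a * norm u + b * norm v < d0" if "0 \<le> a" "a \<le> t" "0 \<le> b" "b \<le> t" for a b
    proof -
      have "a * norm u + b * norm v \<le> t * norm u + t * norm v"
        using that by (intro add_mono mult_right_mono) auto
      also have "\<dots> \<le> t * (norm u + norm v + 1)" using t by (simp add: algebra_simps)
      also have "\<dots> < d0" using t nn by (simp add: d_def pos_less_divide_eq)
      finally show ?thesis .
    qed
    have rb: "norm (r (a *\<^sub>R u + b *\<^sub>R v)) \<le> e' * (t * (norm u + norm v))"
      if "0 \<le> a" "a \<le> t" "0 \<le> b" "b \<le> t" for a b
    proof -
      have n: "norm (a *\<^sub>R u + b *\<^sub>R v) \<le> a * norm u + b * norm v"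
        using that norm_triangle_ineq[of "a *\<^sub>R u" "b *\<^sub>R v"] by simp
      then have "norm (r (a *\<^sub>R u + b *\<^sub>R v)) \<le> e' * norm (a *\<^sub>R u + b *\<^sub>R v)"
        using rem[of "x + (a *\<^sub>R u + b *\<^sub>R v)"] small[OF that] by (simp add: r_def)
      also have "\<dots> \<le> e' * (t * norm u + t * norm v)"
        using n that e' by (intro mult_left_mono order_trans[OF n] add_mono mult_right_mono) auto
      finally show ?thesis by (simp add: algebra_simps)
    qed
    have "\<phi>' s - t * (G v \<bullet> u) = (r (s *\<^sub>R u + t *\<^sub>R v) - r (s *\<^sub>R u + 0 *\<^sub>R v)) \<bullet> u"
      by (simp add: \<phi>'_def r_def G.add G.scaleR algebra_simps inner_diff_left inner_add_left)
    also have "\<bar>\<dots>\<bar> \<le> norm (r (s *\<^sub>R u + t *\<^sub>R v) - r (s *\<^sub>R u + 0 *\<^sub>R v)) * norm u"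
      by (rule Cauchy_Schwarz_ineq2)
    also have "\<dots> \<le> (2 * (e' * (t * (norm u + norm v)))) * norm u"
      using rb[of s t] rb[of s 0] s t
      by (intro mult_right_mono order_trans[OF norm_triangle_ineq4]) auto
    also have "\<dots> = e' * t * (M - 1)" by (simp add: M_def)
    also have "\<dots> \<le> e' * t * M" using e' t by simp
    also have "\<dots> = e * t" using M by (simp add: e'_def)
    finally have fin: "\<bar>\<phi>' s - t * (G v \<bullet> u)\<bar> \<le> e * t" .
    have "f (x + t *\<^sub>R u + t *\<^sub>R v) - f (x + t *\<^sub>R u) - f (x + t *\<^sub>R v) + f x = t * \<phi>' s"
      using mvt by (simp add: \<phi>_def algebra_simps)
    then have "f (x + t *\<^sub>R u + t *\<^sub>R v) - f (x + t *\<^sub>R u) - f (x + t *\<^sub>R v) + f x - t^2 * (G v \<bullet> u)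
        = t * (\<phi>' s - t * (G v \<bullet> u))"
      by (simp add: algebra_simps power2_eq_square)
    then show "\<bar>f (x + t *\<^sub>R u + t *\<^sub>R v) - f (x + t *\<^sub>R u) - f (x + t *\<^sub>R v) + f x - t^2 * (G v \<bullet> u)\<bar> \<le> e * t^2"
      using fin t mult_left_mono[OF fin, of t] by (simp add: abs_mult power2_eq_square mult_ac)
  qed
qed

text \<open>The second difference is symmetric in \<open>u\<close> and \<open>v\<close>, so its two approximations agree in the limit.\<close>

lemma gradient_derivative_symmetric:
  fixes f :: "'a::real_inner \<Rightarrow> real"
  assumes f: "\<And>y. (f has_derivative (\<lambda>h. g y \<bullet> h)) (at y)"
    and g: "(g has_derivative G) (at x)"
  shows "G u \<bullet> v = G v \<bullet> u"
proof (rule ccontr)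
  assume "G u \<bullet> v \<noteq> G v \<bullet> u"
  define e where "e = \<bar>G u \<bullet> v - G v \<bullet> u\<bar> / 3"
  have e: "e > 0" using \<open>G u \<bullet> v \<noteq> G v \<bullet> u\<close> by (simp add: e_def)
  obtain d1 where d1: "d1 > 0" "\<And>t. 0 < t \<Longrightarrow> t < d1 \<Longrightarrow>
    \<bar>f (x + t *\<^sub>R u + t *\<^sub>R v) - f (x + t *\<^sub>R u) - f (x + t *\<^sub>R v) + f x - t^2 * (G v \<bullet> u)\<bar> \<le> e * t^2"
    using second_difference_approx[OF f g e] by blast
  obtain d2 where d2: "d2 > 0" "\<And>t. 0 < t \<Longrightarrow> t < d2 \<Longrightarrow>
    \<bar>f (x + t *\<^sub>R v + t *\<^sub>R u) - f (x + t *\<^sub>R v) - f (x + t *\<^sub>R u) + f x - t^2 * (G u \<bullet> v)\<bar> \<le> e * t^2"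
    using second_difference_approx[OF f g e] by blast
  define t where "t = min d1 d2 / 2"
  have t: "0 < t" "t < d1" "t < d2" using d1(1) d2(1) by (auto simp: t_def)
  have sw: "x + t *\<^sub>R v + t *\<^sub>R u = x + t *\<^sub>R u + t *\<^sub>R v" by simp
  have "\<bar>t^2 * (G u \<bullet> v) - t^2 * (G v \<bullet> u)\<bar> \<le> 2 * (e * t^2)"
    using d1(2)[OF t(1,2)] d2(2)[OF t(1,3)] unfolding sw by linarith
  also have "t^2 * (G u \<bullet> v) - t^2 * (G v \<bullet> u) = t^2 * (G u \<bullet> v - G v \<bullet> u)" by (simp add: algebra_simps)
  finally have "t^2 * (3 * e) \<le> t^2 * (2 * e)" by (simp add: abs_mult e_def mult_ac)
  then show False using t e by simp
qed

section \<open>Gradient and Hessian in matrix coordinates\<close>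

abbreviation matrix_unit :: "'m \<Rightarrow> 'p \<Rightarrow> real^'p^'m" where
  "matrix_unit i j \<equiv> axis i (axis j 1)"

lemma matrix_expansion: 
  fixes h :: "real^'p^'m"
  shows "h = (\<Sum>i\<in>UNIV. \<Sum>j\<in>UNIV. (h $ i $ j) *\<^sub>R matrix_unit i j)"
proof -
  have u: "(h $ i $ j) *\<^sub>R (matrix_unit i j :: real^'p^'m) $ a $ b = (if i = a then if j = b then h $ a $ b else 0 else 0)"
    for i j a b by (simp add: axis_def)
  have "(\<Sum>i\<in>UNIV. \<Sum>j\<in>UNIV. (h $ i $ j) *\<^sub>R matrix_unit i j) $ a $ b = h $ a $ b" for a b
  proof -
    have "(\<Sum>i\<in>UNIV. \<Sum>j\<in>UNIV. (h $ i $ j) *\<^sub>R matrix_unit i j) $ a $ b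
        = (\<Sum>i\<in>UNIV. \<Sum>j\<in>UNIV. if i = a then if j = b then h $ a $ b else 0 else 0)"
      by (simp only: sum_component vector_scaleR_component u)
    also have "\<dots> = (\<Sum>i\<in>UNIV. if i = a then h $ a $ b else 0)"
      by (intro sum.cong refl) simp
    finally show ?thesis by simp
  qed
  then show ?thesis by (simp add: vec_eq_iff)
qed

lemma linear_matrix_expansion:
  fixes g :: "real^'p^'m \<Rightarrow> 'b::real_vector"
  assumes "linear g"
  shows "g h = (\<Sum>i\<in>UNIV. \<Sum>j\<in>UNIV. (h $ i $ j) *\<^sub>R g (matrix_unit i j))"
  by (subst matrix_expansion[of h]) (simp add: linear_sum[OF assms] linear_scale[OF assms])

lemma partial_deriv_eq:
  fixes f :: "real^'p^'m \<Rightarrow> real"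
  assumes "(f has_derivative f') (at X)"
  shows "partial_deriv f i j X = f' (matrix_unit i j)"
proof -
  let ?E = "matrix_unit i j :: real^'p^'m"
  have "((\<lambda>t. X + t *\<^sub>R ?E) has_derivative (\<lambda>h. h *\<^sub>R ?E)) (at 0)"
    by (auto intro!: derivative_eq_intros)
  moreover have "(f has_derivative f') (at (X + 0 *\<^sub>R ?E))" using assms by simp
  ultimately have "((\<lambda>t. f (X + t *\<^sub>R ?E)) has_derivative (\<lambda>h. f' (h *\<^sub>R ?E))) (at 0)"
    by (rule has_derivative_compose)
  then have "DERIV (\<lambda>t. f (X + t *\<^sub>R ?E)) 0 :> f' ?E"
    using linear_scale[OF has_derivative_linear[OF assms]]
    by (simp add: has_field_derivative_def mult_commute_abs)
  then show ?thesis unfolding partial_deriv_def by (rule DERIV_imp_deriv)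
qed

lemma has_derivative_grad:
  fixes f :: "real^'p^'m \<Rightarrow> real"
  assumes "f differentiable (at X)"
  shows "(f has_derivative (\<lambda>h. grad f X \<bullet> h)) (at X)"
proof -
  obtain f' where f': "(f has_derivative f') (at X)"
    using assms unfolding differentiable_def by blast
  have "f' h = grad f X \<bullet> h" for h
    using linear_matrix_expansion[OF has_derivative_linear[OF f'], of h]
    by (simp add: grad_def inner_vec_def partial_deriv_eq[OF f'] mult.commute)
  then show ?thesis using f' by (metis (no_types, lifting) ext)
qed

text \<open>The derivative of the gradient carries the transposed Hessian entries: the definition of
  \<open>hess\<close> puts the outer differentiation on its first index pair, while \<open>hess_apply\<close> sums over the
  second one. The symmetry of second derivatives identifies the two.\<close>

lemma grad_has_derivative_hess:
  fixes f :: "real^'p^'m \<Rightarrow> real"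
  assumes "twice_cont_diff f"
  shows "(grad f has_derivative hess_apply f X) (at X)"
proof -
  obtain G where G: "(grad f has_derivative G) (at X)"
    using assms unfolding twice_cont_diff_def differentiable_def by blast
  have f: "(f has_derivative (\<lambda>h. grad f Y \<bullet> h)) (at Y)" for Y
    using assms by (intro has_derivative_grad) (auto simp: twice_cont_diff_def)
  have pd: "partial_deriv f k l = (\<lambda>Y. grad f Y $ k $ l)" for k l
    by (simp add: grad_def)
  have hess: "hess f X $ i $ j $ k $ l = G (matrix_unit i j) $ k $ l" for i j k l
  proof -
    have "((\<lambda>Y. grad f Y $ k $ l) has_derivative (\<lambda>h. G h $ k $ l)) (at X)"
      using bounded_linear.has_derivative[OF bounded_linear_vec_nth bounded_linear.has_derivative[OF bounded_linear_vec_nth G]] .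
    from partial_deriv_eq[OF this] show ?thesis by (simp add: hess_def pd)
  qed
  have inner_unit: "Y \<bullet> matrix_unit k l = Y $ k $ l" for Y :: "real^'p^'m" and k l
    by (simp add: inner_axis)
  have sym: "hess f X $ i $ j $ k $ l = hess f X $ k $ l $ i $ j" for i j k l
    using gradient_derivative_symmetric[OF f G, of "matrix_unit i j" "matrix_unit k l"]
    by (simp add: hess inner_unit)
  have "G V = hess_apply f X V" for V
  proof -
    have "G V $ i $ j = (\<Sum>k\<in>UNIV. \<Sum>l\<in>UNIV. hess f X $ k $ l $ i $ j * V $ k $ l)" for i j
      by (subst linear_matrix_expansion[OF has_derivative_linear[OF G]]) (simp add: hess mult.commute)
    also have "\<dots> i j = hess_apply f X V $ i $ j" for i j
      unfolding hess_apply_def by (simp add: sym[of i j])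
    finally show ?thesis by (simp add: vec_eq_iff)
  qed
  then show ?thesis using G by (metis (no_types, lifting) ext)
qed

lemma hess_apply_component: "hess_apply f X V $ i $ j = hess f X $ i $ j \<bullet> V"
  by (simp add: hess_apply_def inner_vec_def)

lemma norm_matrix_sq: "(norm (Y :: real^'p^'m))\<^sup>2 = (\<Sum>i\<in>UNIV. \<Sum>j\<in>UNIV. (Y $ i $ j)\<^sup>2)"
  unfolding power2_norm_eq_inner by (simp add: inner_vec_def power2_eq_square)

lemma norm_hess_apply_diff:
  "norm (hess_apply f X V - hess_apply f Y V) \<le> norm (hess f X - hess f Y) * norm V"
proof -
  let ?M = "hess f X - hess f Y"
  have "(norm (hess_apply f X V - hess_apply f Y V))\<^sup>2 = (\<Sum>i\<in>UNIV. \<Sum>j\<in>UNIV. (?M $ i $ j \<bullet> V)\<^sup>2)"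
    by (simp add: norm_matrix_sq hess_apply_component inner_diff_left)
  also have "\<dots> \<le> (\<Sum>i\<in>UNIV. \<Sum>j\<in>UNIV. (norm (?M $ i $ j))\<^sup>2 * (norm V)\<^sup>2)"
    by (intro sum_mono) (metis Cauchy_Schwarz_ineq power2_norm_eq_inner)
  also have "\<dots> = (norm ?M * norm V)\<^sup>2"
    by (simp add: power_mult_distrib power2_norm_eq_inner inner_vec_def sum_distrib_right)
  finally show ?thesis by (rule power2_le_imp_le) auto
qed

text \<open>Integrating the bound \<open>L t (norm (Y - X))\<^sup>2\<close> for the derivative of the error along the segment
  produces the factor 1/2. The cruder mean value estimate has constant \<open>L\<close>, which is too weak for
  the rate \<open>(L + 2 \<rho> C) / c\<close>.\<close>

lemma grad_linearization_bound:
  fixes f :: "real^'p^'m \<Rightarrow> real"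
  assumes f: "twice_cont_diff f" and S: "convex S" "X \<in> S" "Y \<in> S"
    and lip: "\<And>U V. U \<in> S \<Longrightarrow> V \<in> S \<Longrightarrow> norm (hess f U - hess f V) \<le> L * norm (U - V)"
  shows "norm (grad f Y - grad f X - hess_apply f X (Y - X)) \<le> L / 2 * (norm (Y - X))\<^sup>2"
proof -
  let ?W = "Y - X"
  define h where "h t = grad f (X + t *\<^sub>R ?W) - t *\<^sub>R hess_apply f X ?W" for t
  define h' where "h' t = hess_apply f (X + t *\<^sub>R ?W) ?W - hess_apply f X ?W" for t
  define \<phi> where "\<phi> t = L * (norm ?W)\<^sup>2 * (t^2 / 2)" for t :: real
  have der: "(h has_vector_derivative h' t) (at t)" for t
  proof -
    have "((\<lambda>t. X + t *\<^sub>R ?W) has_derivative (\<lambda>h. h *\<^sub>R ?W)) (at t)"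
      by (auto intro!: derivative_eq_intros)
    from has_derivative_compose[OF this grad_has_derivative_hess[OF f]]
    have "((\<lambda>t. grad f (X + t *\<^sub>R ?W)) has_vector_derivative hess_apply f (X + t *\<^sub>R ?W) ?W) (at t)"
      unfolding has_vector_derivative_def
      using linear_scale[OF has_derivative_linear[OF grad_has_derivative_hess[OF f]]] by simp
    then show ?thesis unfolding h_def h'_def by (auto intro!: derivative_eq_intros)
  qed
  have cont: "continuous_on {0..1} h"
    by (meson der continuous_on_vector_derivative has_vector_derivative_at_within)
  have phi: "(\<phi> has_vector_derivative (L * (norm ?W)\<^sup>2 * t)) (at t)" for t
    unfolding \<phi>_def has_real_derivative_iff_has_vector_derivative[symmetric]
    by (auto intro!: derivative_eq_intros)
  have phic: "continuous_on {0..1} \<phi>" unfolding \<phi>_def by (intro continuous_intros) auto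
  have bnd: "norm (h' t) \<le> L * (norm ?W)\<^sup>2 * t" if "0 < t" "t < 1" for t
  proof -
    have "X + t *\<^sub>R ?W = (1 - t) *\<^sub>R X + t *\<^sub>R Y" by (simp add: algebra_simps)
    then have mem: "X + t *\<^sub>R ?W \<in> S" using S that convexD_alt[of S X Y t] by auto
    have "norm (h' t) \<le> norm (hess f (X + t *\<^sub>R ?W) - hess f X) * norm ?W"
      unfolding h'_def by (rule norm_hess_apply_diff)
    also have "\<dots> \<le> (L * norm (t *\<^sub>R ?W)) * norm ?W"
      using lip[OF mem S(2)] by (intro mult_right_mono) auto
    also have "\<dots> = L * (norm ?W)\<^sup>2 * t" using that by (simp add: power2_eq_square)
    finally show ?thesis .
  qed
  have "norm (h 1 - h 0) \<le> \<phi> 1 - \<phi> 0"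
    by (rule differentiable_bound_general[OF _ cont phic der phi bnd]) auto
  then show ?thesis by (simp add: h_def \<phi>_def algebra_simps)
qed

section \<open>Singular values and the Rayleigh quotient\<close>

text \<open>Rayleigh quotient: a minimiser of the form on the unit sphere of \<open>S\<close> is an eigenvector of the
  form relative to the inner product, with the minimum as its eigenvalue. Applied to a form and to
  its negative, this gives the extreme singular values.\<close>

lemma quadratic_form_min_critical:
  fixes B :: "'a::euclidean_space \<Rightarrow> 'a \<Rightarrow> real"
  assumes B: "bilinear B" and sym: "\<And>v w. B v w = B w v"
    and S: "subspace S" "\<exists>v\<in>S. v \<noteq> 0"
  shows "\<exists>\<mu>. \<exists>u\<in>S. u \<noteq> 0 \<and> (\<forall>v\<in>S. \<mu> * (norm v)\<^sup>2 \<le> B v v) \<and> (\<forall>w\<in>S. B u w = \<mu> * (u \<bullet> w))"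
proof -
  obtain a where a: "a \<in> S" "a \<noteq> 0" using S by blast
  have comp: "compact (S \<inter> sphere 0 1)"
    using closed_subspace[OF S(1)] by (intro closed_Int_compact) auto
  have "a /\<^sub>R norm a \<in> S \<inter> sphere 0 1" using a S(1) by (simp add: subspace_scale)
  then have ne: "S \<inter> sphere 0 1 \<noteq> {}" by blast
  have bb: "bounded_bilinear B" using B by (simp add: bilinear_conv_bounded_bilinear)
  have cont: "continuous_on (S \<inter> sphere 0 1) (\<lambda>v. B v v)"
    by (intro bounded_bilinear.continuous_on[OF bb] continuous_on_id)
  obtain u where u: "u \<in> S" "norm u = 1" and min: "\<And>v. v \<in> S \<Longrightarrow> norm v = 1 \<Longrightarrow> B u u \<le> B v v"
    using continuous_attains_inf[OF comp ne cont] by auto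
  define \<mu> where "\<mu> = B u u"
  have low: "\<mu> * (norm v)\<^sup>2 \<le> B v v" if v: "v \<in> S" for v
  proof (cases "v = 0")
    case True then show ?thesis by (simp add: bilinear_lzero[OF B])
  next
    case False
    then have "\<mu> \<le> B (v /\<^sub>R norm v) (v /\<^sub>R norm v)"
      unfolding \<mu>_def using v S(1) by (intro min) (auto simp: subspace_scale)
    also have "\<dots> = B v v / (norm v)\<^sup>2"
      by (simp add: bilinear_lmul[OF B] bilinear_rmul[OF B] power2_eq_square divide_simps)
    finally show ?thesis using False by (simp add: pos_le_divide_eq)
  qed
  have "B u w = \<mu> * (u \<bullet> w)" if w: "w \<in> S" for w
  proof (rule ccontr)
    define p where "p = B u w - \<mu> * (u \<bullet> w)"
    define q where "q = B w w - \<mu> * (norm w)\<^sup>2"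
    assume "B u w \<noteq> \<mu> * (u \<bullet> w)"
    then have p: "p \<noteq> 0" by (simp add: p_def)
    have q: "q \<ge> 0" using low[OF w] by (simp add: q_def)
    \<comment> \<open>The form minus its Rayleigh bound is nonnegative and vanishes at the minimiser,
      so its first variation in any direction is zero.\<close>
    have main: "0 \<le> 2 * t * p + t\<^sup>2 * q" for t
    proof -
      have "u + t *\<^sub>R w \<in> S" using u w S(1) by (simp add: subspace_add subspace_scale)
      then have "\<mu> * (norm (u + t *\<^sub>R w))\<^sup>2 \<le> B (u + t *\<^sub>R w) (u + t *\<^sub>R w)" by (rule low)
      moreover have "B (u + t *\<^sub>R w) (u + t *\<^sub>R w) = \<mu> + 2 * t * B u w + t\<^sup>2 * B w w"
        by (simp add: bilinear_ladd[OF B] bilinear_radd[OF B] bilinear_lmul[OF B] bilinear_rmul[OF B]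
            sym[of w u] \<mu>_def power2_eq_square distrib_left)
      moreover have "(norm (u + t *\<^sub>R w))\<^sup>2 = 1 + 2 * t * (u \<bullet> w) + t\<^sup>2 * (norm w)\<^sup>2"
        unfolding power2_norm_eq_inner using u(2)
        by (simp add: inner_add_left inner_add_right inner_commute[of w u] norm_eq_1 power2_eq_square distrib_left)
      ultimately show ?thesis by (simp add: p_def q_def algebra_simps)
    qed
    have "0 \<le> 2 * (- p / (q + 1)) * p + (- p / (q + 1))\<^sup>2 * q" by (rule main)
    also have "\<dots> = - (p\<^sup>2 * (q + 2) / (q + 1)\<^sup>2)"
    proof -
      have "2 * (- p / (q + 1)) * p = - (2 * p\<^sup>2 * (q + 1)) / (q + 1)\<^sup>2"
        using q by (simp add: power2_eq_square)
      moreover have "(- p / (q + 1))\<^sup>2 * q = (p\<^sup>2 * q) / (q + 1)\<^sup>2" by (simp add: power_divide)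
      ultimately have "2 * (- p / (q + 1)) * p + (- p / (q + 1))\<^sup>2 * q
          = (- (2 * p\<^sup>2 * (q + 1)) + p\<^sup>2 * q) / (q + 1)\<^sup>2"
        by (simp only: add_divide_distrib)
      also have "- (2 * p\<^sup>2 * (q + 1)) + p\<^sup>2 * q = - (p\<^sup>2 * (q + 2))" by (simp add: algebra_simps)
      finally show ?thesis by simp
    qed
    finally have "p\<^sup>2 * (q + 2) / (q + 1)\<^sup>2 \<le> 0" by simp
    moreover have "p\<^sup>2 * (q + 2) / (q + 1)\<^sup>2 > 0" using p q by simp
    ultimately show False by linarith
  qed
  then show ?thesis using low u by (intro exI[of _ \<mu>] bexI[of _ u]) auto
qed

text \<open>A matrix indexed by \<open>I\<close> acts on the vectors supported in \<open>I\<close>, which makes a Euclidean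
  space out of an index set that is not a type.\<close>

definition supported_on :: "'k set \<Rightarrow> (real^'k) set" where
  "supported_on I = {v. \<forall>i. i \<notin> I \<longrightarrow> v $ i = 0}"

definition submatrix_op :: "'k set \<Rightarrow> ('k \<Rightarrow> 'k \<Rightarrow> real) \<Rightarrow> real^'k \<Rightarrow> real^'k" where
  "submatrix_op I M v = (\<chi> i. if i \<in> I then \<Sum>j\<in>I. M i j * v $ j else 0)"

lemma subspace_supported_on: "subspace (supported_on I)"
  by (auto simp: subspace_def supported_on_def)

lemma linear_submatrix_op: "linear (submatrix_op I M)"
  by (rule linearI)
    (auto simp: submatrix_op_def vec_eq_iff algebra_simps sum.distrib sum_distrib_left)

lemma inner_supported_on:
  fixes v w :: "real^'k"
  assumes "v \<in> supported_on I"
  shows "v \<bullet> w = (\<Sum>i\<in>I. v $ i * w $ i)"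
  unfolding inner_vec_def using assms
  by (intro sum.mono_neutral_cong_right) (auto simp: supported_on_def)

lemma submatrix_op_gram:
  fixes v w :: "real^'k"
  shows "submatrix_op I M v \<bullet> submatrix_op I M w
    = (\<Sum>i\<in>I. (\<Sum>j\<in>I. (\<Sum>k\<in>I. M k i * M k j) * v $ j) * w $ i)"
proof -
  have "submatrix_op I M v \<bullet> submatrix_op I M w
      = (\<Sum>k\<in>I. (\<Sum>j\<in>I. M k j * v $ j) * (\<Sum>i\<in>I. M k i * w $ i))"
    by (subst inner_supported_on[of _ I]) (auto simp: submatrix_op_def supported_on_def)
  also have "\<dots> = (\<Sum>k\<in>I. \<Sum>i\<in>I. \<Sum>j\<in>I. M k i * M k j * v $ j * w $ i)"
    by (simp add: sum_distrib_left sum_distrib_right mult_ac)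
  also have "\<dots> = (\<Sum>i\<in>I. \<Sum>k\<in>I. \<Sum>j\<in>I. M k i * M k j * v $ j * w $ i)"
    by (rule sum.swap)
  also have "\<dots> = (\<Sum>i\<in>I. \<Sum>j\<in>I. \<Sum>k\<in>I. M k i * M k j * v $ j * w $ i)"
    by (intro sum.cong refl sum.swap)
  finally show ?thesis by (simp add: sum_distrib_right)
qed

text \<open>The weak formulation of the eigenvalue equation of the Gram matrix, in a space where compactness
  and orthogonality are available.\<close>

lemma eigenvalue_on_gram_iff:
  fixes M :: "'k::finite \<Rightarrow> 'k \<Rightarrow> real"
  shows "eigenvalue_on I (\<lambda>i j. \<Sum>k\<in>I. M k i * M k j) \<mu> \<longleftrightarrow>
    (\<exists>v\<in>supported_on I. v \<noteq> 0 \<and>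
      (\<forall>w\<in>supported_on I. submatrix_op I M v \<bullet> submatrix_op I M w = \<mu> * (v \<bullet> w)))"
    (is "?l \<longleftrightarrow> ?r")
proof
  assume ?l
  then obtain x where x: "\<exists>i\<in>I. x i \<noteq> 0"
    and ev: "\<And>i. i \<in> I \<Longrightarrow> (\<Sum>j\<in>I. (\<Sum>k\<in>I. M k i * M k j) * x j) = \<mu> * x i"
    unfolding eigenvalue_on_def by blast
  define v :: "real^'k" where "v = (\<chi> i. if i \<in> I then x i else 0)"
  have v: "v \<in> supported_on I" "v \<noteq> 0" using x by (auto simp: v_def supported_on_def vec_eq_iff)
  have "submatrix_op I M v \<bullet> submatrix_op I M w = \<mu> * (v \<bullet> w)" for w
  proof -
    have "(\<Sum>j\<in>I. (\<Sum>k\<in>I. M k i * M k j) * v $ j) = \<mu> * v $ i" if "i \<in> I" for i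
      using ev[OF that] that by (simp add: v_def)
    then show ?thesis
      unfolding submatrix_op_gram inner_supported_on[OF v(1)] by (simp add: sum_distrib_left mult.assoc)
  qed
  then show ?r using v by blast
next
  assume ?r
  then obtain v where v: "v \<in> supported_on I" "v \<noteq> 0"
    and ev: "\<And>w. w \<in> supported_on I \<Longrightarrow>
      submatrix_op I M v \<bullet> submatrix_op I M w = \<mu> * (v \<bullet> w)" by blast
  have "(\<Sum>j\<in>I. (\<Sum>k\<in>I. M k i * M k j) * v $ j) = \<mu> * v $ i" if i: "i \<in> I" for i
  proof -
    have "axis i 1 \<in> supported_on I" using i by (auto simp: supported_on_def axis_def)
    note ev = ev[OF this]
    have pick: "(\<Sum>k\<in>I. h k * axis i (1::real) $ k) = h i" for h :: "'k \<Rightarrow> real"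
    proof -
      have "(\<Sum>k\<in>I. h k * axis i (1::real) $ k) = (\<Sum>k\<in>I. if k = i then h k else 0)"
        by (intro sum.cong) (auto simp: axis_def)
      then show ?thesis using i by simp
    qed
    show ?thesis using ev by (simp only: submatrix_op_gram pick inner_axis) simp
  qed
  moreover have "\<exists>i\<in>I. v $ i \<noteq> 0" using v by (auto simp: supported_on_def vec_eq_iff)
  ultimately show ?l unfolding eigenvalue_on_def by blast
qed

text \<open>Eigenvectors of the Gram matrix for different eigenvalues are orthogonal, hence independent.
  Finiteness makes the minimum and maximum in \<open>sigma_min\<close> and \<open>sigma_max\<close> meaningful.\<close>

lemma finite_singular_values:
  fixes M :: "'k::finite \<Rightarrow> 'k \<Rightarrow> real"
  shows "finite (singular_values I M)"
proof -
  let ?E = "{\<mu>. eigenvalue_on I (\<lambda>i j. \<Sum>k\<in>I. M k i * M k j) \<mu>}"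
  have "\<forall>\<mu>\<in>?E. \<exists>v. v \<in> supported_on I \<and> v \<noteq> 0 \<and>
      (\<forall>w\<in>supported_on I. submatrix_op I M v \<bullet> submatrix_op I M w = \<mu> * (v \<bullet> w))"
    by (auto simp: eigenvalue_on_gram_iff)
  from bchoice[OF this] obtain e where e: "\<And>\<mu>. \<mu> \<in> ?E \<Longrightarrow> e \<mu> \<in> supported_on I \<and> e \<mu> \<noteq> 0 \<and>
      (\<forall>w\<in>supported_on I. submatrix_op I M (e \<mu>) \<bullet> submatrix_op I M w = \<mu> * (e \<mu> \<bullet> w))"
    by blast
  have orth: "e \<mu> \<bullet> e \<nu> = 0" if "\<mu> \<in> ?E" "\<nu> \<in> ?E" "\<mu> \<noteq> \<nu>" for \<mu> \<nu>
  proof -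
    have "\<mu> * (e \<mu> \<bullet> e \<nu>) = \<nu> * (e \<nu> \<bullet> e \<mu>)"
    proof -
      have "submatrix_op I M (e \<mu>) \<bullet> submatrix_op I M (e \<nu>) = \<mu> * (e \<mu> \<bullet> e \<nu>)"
        using e[OF that(1)] e[OF that(2)] by blast
      moreover have "submatrix_op I M (e \<nu>) \<bullet> submatrix_op I M (e \<mu>) = \<nu> * (e \<nu> \<bullet> e \<mu>)"
        using e[OF that(1)] e[OF that(2)] by blast
      ultimately show ?thesis by (simp add: inner_commute)
    qed
    then show ?thesis using that(3) by (simp add: inner_commute)
  qed
  have inj: "inj_on e ?E"
  proof (rule inj_onI, rule ccontr)
    fix \<mu> \<nu> assume h: "\<mu> \<in> ?E" "\<nu> \<in> ?E" "e \<mu> = e \<nu>" "\<mu> \<noteq> \<nu>"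
    then show False using orth[OF h(1,2,4)] e[OF h(2)] by simp
  qed
  have "pairwise orthogonal (e ` ?E)"
    unfolding pairwise_def orthogonal_def using orth by blast
  moreover have "0 \<notin> e ` ?E" using e by force
  ultimately have "independent (e ` ?E)" by (rule pairwise_orthogonal_independent)
  then have "finite (e ` ?E)" by (rule independent_imp_finite)
  then have "finite ?E" using inj by (rule finite_imageD)
  then have "finite (sqrt ` ?E)" by simp
  then show ?thesis by (simp add: singular_values_def setcompr_eq_image)
qed

lemma singular_value_bounds:
  fixes M :: "'k::finite \<Rightarrow> 'k \<Rightarrow> real"
  assumes "I \<noteq> {}"
  shows "sigma_min I M * L2_set x I \<le> L2_set (\<lambda>i. \<Sum>j\<in>I. M i j * x j) I"
    and "L2_set (\<lambda>i. \<Sum>j\<in>I. M i j * x j) I \<le> sigma_max I M * L2_set x I"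
proof -
  let ?g = "submatrix_op I M" and ?S = "supported_on I"
  let ?B = "\<lambda>v w. ?g v \<bullet> ?g w"
  define v :: "real^'k" where "v = (\<chi> i. if i \<in> I then x i else 0)"
  have v: "v \<in> ?S" by (simp add: v_def supported_on_def)
  have nv: "norm v = L2_set x I"
    by (simp add: norm_eq_sqrt_inner inner_supported_on[OF v] L2_set_def power2_eq_square)
       (simp add: v_def)
  have gS: "?g v \<in> ?S" by (simp add: submatrix_op_def supported_on_def)
  have ngv: "norm (?g v) = L2_set (\<lambda>i. \<Sum>j\<in>I. M i j * x j) I"
    by (simp add: norm_eq_sqrt_inner inner_supported_on[OF gS] L2_set_def power2_eq_square)
       (simp add: submatrix_op_def v_def)
  obtain i where i: "i \<in> I" using assms by blast
  have ne: "\<exists>v\<in>?S. v \<noteq> 0"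
    using i by (intro bexI[of _ "axis i 1"]) (auto simp: supported_on_def axis_def vec_eq_iff)
  have bil: "bilinear ?B"
    unfolding bilinear_def using linear_submatrix_op[of I M]
    by (auto intro!: linearI simp: linear_add linear_scale inner_add_left inner_add_right)
  have bil': "bilinear (\<lambda>v w. - ?B v w)"
    unfolding bilinear_def using linear_submatrix_op[of I M]
    by (auto intro!: linearI simp: linear_add linear_scale inner_add_left inner_add_right)
  obtain \<mu> u where u: "u \<in> ?S" "u \<noteq> 0" "\<And>w. w \<in> ?S \<Longrightarrow> ?B u w = \<mu> * (u \<bullet> w)"
    and low: "\<And>w. w \<in> ?S \<Longrightarrow> \<mu> * (norm w)\<^sup>2 \<le> ?B w w"
    using quadratic_form_min_critical[OF bil _ subspace_supported_on ne] by (auto simp: inner_commute)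
  have "sqrt \<mu> \<in> singular_values I M"
    unfolding singular_values_def using u by (auto simp: eigenvalue_on_gram_iff)
  then have "sigma_min I M \<le> sqrt \<mu>"
    unfolding sigma_min_def by (intro Min_le finite_singular_values)
  then have "sigma_min I M * norm v \<le> sqrt \<mu> * norm v" by (simp add: mult_right_mono)
  also have "\<dots> = sqrt (\<mu> * (norm v)\<^sup>2)" by (simp add: real_sqrt_mult)
  also have "\<dots> \<le> norm (?g v)" using low[OF v] by (simp add: norm_eq_sqrt_inner)
  finally show "sigma_min I M * L2_set x I \<le> L2_set (\<lambda>i. \<Sum>j\<in>I. M i j * x j) I"
    by (simp add: nv ngv)
  obtain \<nu> t where t: "t \<in> ?S" "t \<noteq> 0" "\<And>w. w \<in> ?S \<Longrightarrow> - ?B t w = \<nu> * (t \<bullet> w)"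
    and up: "\<And>w. w \<in> ?S \<Longrightarrow> \<nu> * (norm w)\<^sup>2 \<le> - ?B w w"
    using quadratic_form_min_critical[OF bil' _ subspace_supported_on ne] by (auto simp: inner_commute)
  have "?B t w = (- \<nu>) * (t \<bullet> w)" if "w \<in> ?S" for w using t(3)[OF that] by simp
  then have "sqrt (- \<nu>) \<in> singular_values I M"
    unfolding singular_values_def using t by (auto simp: eigenvalue_on_gram_iff)
  then have le: "sqrt (- \<nu>) \<le> sigma_max I M"
    unfolding sigma_max_def by (intro Max_ge finite_singular_values)
  have "norm (?g v) \<le> sqrt (- \<nu> * (norm v)\<^sup>2)" using up[OF v] by (simp add: norm_eq_sqrt_inner)
  also have "\<dots> = sqrt (- \<nu>) * norm v" by (simp add: real_sqrt_mult real_sqrt_minus)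
  also have "\<dots> \<le> sigma_max I M * norm v" using le by (simp add: mult_right_mono)
  finally show "L2_set (\<lambda>i. \<Sum>j\<in>I. M i j * x j) I \<le> sigma_max I M * L2_set x I"
    by (simp add: nv ngv)
qed

section \<open>The Newton operator and its norm bounds\<close>

text \<open>The left-hand side of the Newton system; for \<open>\<gamma> = 0\<close> it is the derivative of \<open>\<Psi>(\<cdot>; T)\<close>.\<close>

definition newton_op ::
    "(real^'p^'m \<Rightarrow> real) \<Rightarrow> ('n::finite \<Rightarrow> real^'p^'m) \<Rightarrow> real^'p^'m \<Rightarrow> 'n set \<Rightarrow> real \<Rightarrow>
     (real^'p^'m) \<times> (real^'n) \<Rightarrow> (real^'p^'m) \<times> (real^'n)" where
  "newton_op f A X T \<gamma> d =
     (hess_apply f X (fst d) + adjoint_on A T (snd d),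
      \<chi> i. if i \<in> T then A i \<bullet> fst d - \<gamma> * snd d $ i else snd d $ i)"

lemma norm_pair_sq: "(norm (p :: 'a::real_normed_vector \<times> 'b::real_normed_vector))\<^sup>2
    = (norm (fst p))\<^sup>2 + (norm (snd p))\<^sup>2"
  by (cases p) (simp add: norm_Pair)

lemma norm_vec_sq_split:
  fixes w :: "real^'n"
  shows "(norm w)\<^sup>2 = (\<Sum>i\<in>T. (w $ i)\<^sup>2) + (\<Sum>i\<in>-T. (w $ i)\<^sup>2)"
proof -
  have "(norm w)\<^sup>2 = (\<Sum>i\<in>UNIV. (w $ i)\<^sup>2)"
    unfolding power2_norm_eq_inner by (simp add: inner_vec_def power2_eq_square)
  also have "\<dots> = (\<Sum>i\<in>T \<union> - T. (w $ i)\<^sup>2)" by simp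
  also have "\<dots> = (\<Sum>i\<in>T. (w $ i)\<^sup>2) + (\<Sum>i\<in>-T. (w $ i)\<^sup>2)"
    by (rule sum.union_disjoint) auto
  finally show ?thesis .
qed

lemma sum_UNIV_Plus:
  fixes h :: "('m::finite \<times> 'p::finite) + 'n::finite \<Rightarrow> real"
  shows "(\<Sum>i\<in>UNIV <+> T. h i) = (\<Sum>i\<in>UNIV. \<Sum>j\<in>UNIV. h (Inl (i, j))) + (\<Sum>s\<in>T. h (Inr s))"
  by (simp add: sum.Plus sum.cartesian_product o_def UNIV_Times_UNIV[symmetric] del: UNIV_Times_UNIV)

text \<open>The entries of \<open>H(T)\<close> describe the block operator that sends \<open>(V, w)\<close> to
  \<open>(\<nabla>\<^sup>2f V + A\<^sub>T\<^sup>T w, A\<^sub>T V)\<close>.\<close>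

lemma H_entry_action:
  fixes f :: "real^'p^'m \<Rightarrow> real" and A :: "'n::finite \<Rightarrow> real^'p^'m"
  defines "x V w \<equiv> case_sum (\<lambda>(i, j). V $ i $ j) (\<lambda>s. w $ s)"
  shows "(L2_set (x V w) (UNIV <+> T))\<^sup>2 = (norm V)\<^sup>2 + (\<Sum>s\<in>T. (w $ s)\<^sup>2)"
    and "(L2_set (\<lambda>i. \<Sum>j\<in>UNIV <+> T. H_entry f A X i j * x V w j) (UNIV <+> T))\<^sup>2
      = (norm (hess_apply f X V + adjoint_on A T w))\<^sup>2 + (\<Sum>s\<in>T. (A s \<bullet> V)\<^sup>2)"
proof -
  show "(L2_set (x V w) (UNIV <+> T))\<^sup>2 = (norm V)\<^sup>2 + (\<Sum>s\<in>T. (w $ s)\<^sup>2)"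
    by (simp add: L2_set_def sum_nonneg sum_UNIV_Plus norm_matrix_sq x_def)
  have l: "(\<Sum>j\<in>UNIV <+> T. H_entry f A X (Inl (i, j')) j * x V w j)
      = (hess_apply f X V + adjoint_on A T w) $ i $ j'" for i j'
    by (simp add: sum_UNIV_Plus x_def hess_apply_def adjoint_on_def mult.commute)
  have r: "(\<Sum>j\<in>UNIV <+> T. H_entry f A X (Inr s) j * x V w j) = A s \<bullet> V" for s
    by (simp add: sum_UNIV_Plus x_def inner_vec_def)
  show "(L2_set (\<lambda>i. \<Sum>j\<in>UNIV <+> T. H_entry f A X i j * x V w j) (UNIV <+> T))\<^sup>2
      = (norm (hess_apply f X V + adjoint_on A T w))\<^sup>2 + (\<Sum>s\<in>T. (A s \<bullet> V)\<^sup>2)"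
    unfolding L2_set_def
    by (subst real_sqrt_pow2, simp add: sum_nonneg)
       (simp only: sum_UNIV_Plus[of "\<lambda>i. (\<Sum>j\<in>UNIV <+> T. H_entry f A X i j * x V w j)\<^sup>2"] l r norm_matrix_sq)
qed

lemma norm_newton_op_sq:
  "(norm (newton_op f A X T 0 (V, w)))\<^sup>2
    = (norm (hess_apply f X V + adjoint_on A T w))\<^sup>2 + (\<Sum>s\<in>T. (A s \<bullet> V)\<^sup>2) + (\<Sum>s\<in>-T. (w $ s)\<^sup>2)"
  by (simp add: newton_op_def norm_pair_sq norm_vec_sq_split[of _ T])

lemma sum_weighted_ge:
  fixes m s a b A B :: real
  assumes "0 \<le> m" "m \<le> 1" "m \<le> s" "s\<^sup>2 * a \<le> A" "0 \<le> a" "0 \<le> b"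
  shows "m\<^sup>2 * (a + b) \<le> A + b"
proof -
  have "m\<^sup>2 * a \<le> s\<^sup>2 * a" using assms by (intro mult_right_mono power_mono) auto
  moreover have "m\<^sup>2 * b \<le> 1 * b" using assms by (intro mult_right_mono) (auto simp: power_le_one)
  ultimately show ?thesis using assms by (simp add: algebra_simps)
qed

text \<open>\<open>newton_op\<close> with regularisation 0 is the direct sum of \<open>H(T)\<close> and the identity on the
  complementary block; this is the reason for the term 1 in the minimum that defines \<open>c_star\<close>.\<close>

lemma newton_op_lower_bound:
  assumes T: "T \<subseteq> active_set A X" and c: "c_star f A X > 0"
  shows "2 * c_star f A X * norm v \<le> norm (newton_op f A X T 0 v)"
proof -
  obtain V w where v: "v = (V, w)" by (cases v)
  let ?s = "sigma_min (UNIV <+> T) (H_entry f A X)"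
  let ?m = "2 * c_star f A X"
  have fin: "finite {sigma_min (UNIV <+> T) (H_entry f A X) |T. T \<subseteq> active_set A X}"
    by (rule finite_image_set) auto
  have ms: "?m \<le> ?s" "?m \<le> 1"
  proof -
    have "Min {sigma_min (UNIV <+> T) (H_entry f A X) |T. T \<subseteq> active_set A X} \<le> ?s"
      using T by (intro Min_le fin) blast
    then show "?m \<le> ?s" "?m \<le> 1" unfolding c_star_def by auto
  qed
  have "(?s * L2_set (case_sum (\<lambda>(i, j). V $ i $ j) (\<lambda>s. w $ s)) (UNIV <+> T))\<^sup>2
     \<le> (norm (hess_apply f X V + adjoint_on A T w))\<^sup>2 + (\<Sum>s\<in>T. (A s \<bullet> V)\<^sup>2)"
    unfolding H_entry_action(2)[symmetric]
    using ms c by (intro power_mono singular_value_bounds) (auto simp: Plus_def L2_set_nonneg)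
  then have "?m\<^sup>2 * (((norm V)\<^sup>2 + (\<Sum>s\<in>T. (w $ s)\<^sup>2)) + (\<Sum>s\<in>-T. (w $ s)\<^sup>2))
     \<le> ((norm (hess_apply f X V + adjoint_on A T w))\<^sup>2 + (\<Sum>s\<in>T. (A s \<bullet> V)\<^sup>2)) + (\<Sum>s\<in>-T. (w $ s)\<^sup>2)"
    using ms c by (intro sum_weighted_ge[where s = ?s])
      (auto simp: power_mult_distrib H_entry_action(1) sum_nonneg)
  then have "(?m * norm v)\<^sup>2 \<le> (norm (newton_op f A X T 0 v))\<^sup>2"
    unfolding v norm_newton_op_sq power_mult_distrib norm_pair_sq[of "(V, w)"]
    using norm_vec_sq_split[of w T] by (simp add: add.assoc)
  then show ?thesis by (rule power2_le_imp_le) simp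
qed

text \<open>Padding \<open>w\<close> by zeros shows that \<open>H(T)\<close> is a submatrix of \<open>H\<close> of the whole active set, so the
  single matrix in \<open>C_star\<close> serves all \<open>T\<close>.\<close>

lemma newton_op_upper_bound:
  assumes T: "T \<subseteq> active_set A X"
  shows "norm (newton_op f A X T 0 v) \<le> C_star f A X / 2 * norm v"
proof -
  obtain V w where v: "v = (V, w)" by (cases v)
  define T' where "T' = active_set A X"
  define w' where "w' = (\<chi> i. if i \<in> T then w $ i else 0)"
  let ?s = "sigma_max (UNIV <+> T') (H_entry f A X)"
  let ?m = "C_star f A X / 2"
  have ms: "?s \<le> ?m" "1 \<le> ?m" by (auto simp: C_star_def T'_def)
  have sub: "T \<subseteq> T'" using T by (simp add: T'_def)
  have adj: "adjoint_on A T' w' = adjoint_on A T w"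
    unfolding adjoint_on_def w'_def using sub
    by (intro sum.mono_neutral_cong_right) auto
  have w'sum: "(\<Sum>s\<in>T'. (w' $ s)\<^sup>2) = (\<Sum>s\<in>T. (w $ s)\<^sup>2)"
    unfolding w'_def using sub by (intro sum.mono_neutral_cong_right) auto
  let ?a = "(norm V)\<^sup>2 + (\<Sum>s\<in>T. (w $ s)\<^sup>2)"
  have "L2_set (\<lambda>i. \<Sum>j\<in>UNIV <+> T'. H_entry f A X i j * case_sum (\<lambda>(i, j). V $ i $ j) (\<lambda>s. w' $ s) j) (UNIV <+> T')
     \<le> ?s * L2_set (case_sum (\<lambda>(i, j). V $ i $ j) (\<lambda>s. w' $ s)) (UNIV <+> T')"
    by (intro singular_value_bounds) (auto simp: Plus_def)
  also have "\<dots> \<le> ?m * L2_set (case_sum (\<lambda>(i, j). V $ i $ j) (\<lambda>s. w' $ s)) (UNIV <+> T')"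
    using ms by (intro mult_right_mono L2_set_nonneg)
  finally have "(L2_set (\<lambda>i. \<Sum>j\<in>UNIV <+> T'. H_entry f A X i j * case_sum (\<lambda>(i, j). V $ i $ j) (\<lambda>s. w' $ s) j) (UNIV <+> T'))\<^sup>2
     \<le> (?m * L2_set (case_sum (\<lambda>(i, j). V $ i $ j) (\<lambda>s. w' $ s)) (UNIV <+> T'))\<^sup>2"
    by (rule power_mono) (rule L2_set_nonneg)
  then have 1: "(norm (hess_apply f X V + adjoint_on A T w))\<^sup>2 + (\<Sum>s\<in>T'. (A s \<bullet> V)\<^sup>2) \<le> ?m\<^sup>2 * ?a"
    unfolding H_entry_action power_mult_distrib adj w'sum .
  have 2: "(\<Sum>s\<in>T. (A s \<bullet> V)\<^sup>2) \<le> (\<Sum>s\<in>T'. (A s \<bullet> V)\<^sup>2)"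
    using sub by (intro sum_mono2) auto
  have 3: "1 * (\<Sum>s\<in>-T. (w $ s)\<^sup>2) \<le> ?m\<^sup>2 * (\<Sum>s\<in>-T. (w $ s)\<^sup>2)"
    using ms by (intro mult_right_mono sum_nonneg) (auto simp: one_le_power)
  have "(norm (newton_op f A X T 0 v))\<^sup>2 \<le> ?m\<^sup>2 * ?a + ?m\<^sup>2 * (\<Sum>s\<in>-T. (w $ s)\<^sup>2)"
    unfolding v norm_newton_op_sq using 1 2 3 by linarith
  also have "\<dots> = (?m * norm v)\<^sup>2"
    unfolding v power_mult_distrib norm_pair_sq[of "(V, w)"] using norm_vec_sq_split[of w T] by (simp add: algebra_simps)
  finally show ?thesis using ms by (intro power2_le_imp_le[OF _ mult_nonneg_nonneg]) auto
qed

lemma linear_newton_op: "linear (newton_op f A X T \<gamma>)"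
  by (rule linearI)
    (auto simp: newton_op_def hess_apply_def adjoint_on_def vec_eq_iff algebra_simps sum.distrib
      sum_distrib_left scaleR_sum_right inner_add_right)

lemma newton_system_iff: "newton_system f A X z T \<gamma> d \<longleftrightarrow> newton_op f A X T \<gamma> d = - Psi f A X z T"
  by (auto simp: newton_system_def newton_op_def Psi_def prod_eq_iff vec_eq_iff)

text \<open>All parts of \<open>\<Psi>\<close> but the gradient of \<open>f\<close> are affine in \<open>(X, z)\<close>, so the only linearisation
  error is that of the gradient.\<close>

lemma Psi_diff:
  "Psi f A X z T - Psi f A Y y T
    = newton_op f A U T 0 ((X, z) - (Y, y)) + (grad f X - grad f Y - hess_apply f U (X - Y), 0)"
  by (auto simp: Psi_def newton_op_def prod_eq_iff vec_eq_iff Fmap_def adjoint_on_def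
      algebra_simps inner_diff_right sum_subtractf)

lemma newton_op_diff_bound:
  "norm (newton_op f A X T \<gamma> d - newton_op f A Y T 0 d)
    \<le> (norm (hess f X - hess f Y) + \<bar>\<gamma>\<bar>) * norm d"
proof -
  let ?r = "\<chi> i. if i \<in> T then \<gamma> * snd d $ i else 0"
  have "newton_op f A X T \<gamma> d - newton_op f A Y T 0 d
      = (hess_apply f X (fst d) - hess_apply f Y (fst d), 0) - (0, ?r)"
    by (auto simp: newton_op_def prod_eq_iff vec_eq_iff)
  also have "norm \<dots> \<le> norm (hess_apply f X (fst d) - hess_apply f Y (fst d)) + norm ?r"
    by (rule order_trans[OF norm_triangle_ineq4]) (simp add: norm_Pair)
  also have "\<dots> \<le> norm (hess f X - hess f Y) * norm d + \<bar>\<gamma>\<bar> * norm d"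
  proof (rule add_mono)
    show "norm (hess_apply f X (fst d) - hess_apply f Y (fst d)) \<le> norm (hess f X - hess f Y) * norm d"
      by (rule order_trans[OF norm_hess_apply_diff])
        (metis mult_left_mono norm_ge_zero norm_fst_le prod.collapse)
    have "norm ?r \<le> norm (\<gamma> *\<^sub>R snd d)"
      by (rule norm_le_componentwise_cart) simp
    also have "\<dots> \<le> \<bar>\<gamma>\<bar> * norm d"
      by (simp add: mult_left_mono norm_snd_le[of "snd d" "fst d", simplified])
    finally show "norm ?r \<le> \<bar>\<gamma>\<bar> * norm d" .
  qed
  finally show ?thesis by (simp add: algebra_simps)
qed

section \<open>One Newton step\<close>

text \<open>\<open>c\<close> and \<open>C\<close> may be any constants that bound the derivative at the solution
  uniformly over the subsets of the active set.\<close>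

locale newton_region =
  fixes f :: "real^'p^'m \<Rightarrow> real" and A :: "'n::finite \<Rightarrow> real^'p^'m"
    and Xs :: "real^'p^'m" and zs :: "real^'n" and L \<rho> c C r :: real
  assumes C2: "twice_cont_diff f"
    and lip: "\<And>U V. U \<in> ball Xs r \<Longrightarrow> V \<in> ball Xs r \<Longrightarrow> norm (hess f U - hess f V) \<le> L * norm (U - V)"
    and constants: "L > 0" "\<rho> > 0" "c > 0" "c \<le> 1 / 2" "C \<ge> 2"
    and r: "r \<le> c / (2 * L)" "r \<le> c / (2 * (L + 2 * \<rho> * C))"
    and lower: "\<And>T v. T \<subseteq> active_set A Xs \<Longrightarrow> 2 * c * norm v \<le> norm (newton_op f A Xs T 0 v)"
    and upper: "\<And>T v. T \<subseteq> active_set A Xs \<Longrightarrow> norm (newton_op f A Xs T 0 v) \<le> C / 2 * norm v"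
begin

text \<open>The index sets for which the solution is a root of the smooth equation that the step linearises.\<close>

definition admissible :: "'n set \<Rightarrow> bool" where
  "admissible T \<longleftrightarrow> T \<subseteq> active_set A Xs \<and> Psi f A Xs zs T = 0"

abbreviation err :: "real^'p^'m \<Rightarrow> real^'n \<Rightarrow> real" where
  "err X z \<equiv> norm ((X, z) - (Xs, zs))"

lemma K_pos: "L + 2 * \<rho> * C > 0"
  using constants by (intro add_pos_pos mult_pos_pos) auto

lemma err_small:
  assumes "err X z < r"
  shows "X \<in> ball Xs r" "Xs \<in> ball Xs r" "L * err X z \<le> c / 2" "norm (X - Xs) \<le> err X z"
    "(L + 2 * \<rho> * C) * err X z \<le> c / 2"
proof -
  show fs: "norm (X - Xs) \<le> err X z" using norm_fst_le[of "X - Xs" "z - zs"] by simp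
  then show "X \<in> ball Xs r" using assms by (simp add: dist_norm norm_minus_commute)
  have "0 \<le> err X z" by simp
  then show "Xs \<in> ball Xs r" using assms by (simp only: centre_in_ball)
  have "err X z \<le> c / (2 * L)" using assms r by linarith
  then show "L * err X z \<le> c / 2" using constants by (simp add: field_simps)
  have "err X z \<le> c / (2 * (L + 2 * \<rho> * C))" using assms r by linarith
  then show "(L + 2 * \<rho> * C) * err X z \<le> c / 2" using K_pos by (simp add: pos_le_divide_eq distrib_left mult_ac)
qed

lemma grad_remainder:
  assumes "err X z < r" "U \<in> {X, Xs}"
  shows "norm (grad f X - grad f Xs - hess_apply f U (X - Xs)) \<le> L / 2 * (err X z)\<^sup>2"
proof -
  note e = err_small[OF assms(1)]
  have "L / 2 * (norm (X - Xs))\<^sup>2 \<le> L / 2 * (err X z)\<^sup>2"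
    using e(4) constants by (intro mult_left_mono power_mono) auto
  moreover have "norm (grad f X - grad f Xs - hess_apply f U (X - Xs)) \<le> L / 2 * (norm (X - Xs))\<^sup>2"
  proof (cases "U = Xs")
    case True
    then show ?thesis using grad_linearization_bound[OF C2 convex_ball e(2,1) lip] by simp
  next
    case False
    then have U: "U = X" using assms by simp
    have "hess_apply f X (Xs - X) = - hess_apply f X (X - Xs)"
      by (simp add: hess_apply_def vec_eq_iff right_diff_distrib sum_subtractf)
    then have "grad f Xs - grad f X - hess_apply f X (Xs - X)
        = - (grad f X - grad f Xs - hess_apply f X (X - Xs))" by simp
    then show ?thesis
      using grad_linearization_bound[OF C2 convex_ball e(1,2) lip] U
      by (metis norm_minus_cancel norm_minus_commute)
  qed
  ultimately show ?thesis by linarith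
qed

text \<open>Linearisation at \<open>X*\<close>: the remainder \<open>L / 2 e\<^sup>2\<close> is at most \<open>c e / 4\<close> in the region.\<close>

lemma Psi_bounds:
  assumes e: "err X z < r" and T: "admissible T"
  shows "norm (Psi f A X z T) \<le> C * err X z" "c * err X z \<le> norm (Psi f A X z T)"
proof -
  let ?J = "newton_op f A Xs T 0 ((X, z) - (Xs, zs))"
  let ?R = "(grad f X - grad f Xs - hess_apply f Xs (X - Xs), 0 :: real^'n)"
  have eq: "Psi f A X z T = ?J + ?R"
    using Psi_diff[of f A X z T Xs zs Xs] T by (simp add: admissible_def)
  have "norm ?R \<le> L / 2 * (err X z)\<^sup>2"
    using grad_remainder[OF e, of Xs] by (simp add: norm_Pair)
  also have "\<dots> = (L * err X z) * err X z / 2" by (simp add: power2_eq_square)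
  also have "\<dots> \<le> c / 2 * err X z / 2"
    using err_small(3)[OF e] by (intro divide_right_mono mult_right_mono) auto
  finally have R: "norm ?R \<le> c * err X z / 4" by simp
  have J: "2 * c * err X z \<le> norm ?J" "norm ?J \<le> C / 2 * err X z"
    using lower upper T unfolding admissible_def by blast+
  have pos: "0 \<le> c * err X z" using constants by simp
  have "c * err X z \<le> C / 2 * err X z" using constants by (intro mult_right_mono) auto
  then have "norm ?J + norm ?R \<le> C * err X z" using J R pos by linarith
  then show "norm (Psi f A X z T) \<le> C * err X z"
    unfolding eq using norm_triangle_ineq[of ?J ?R] by linarith
  have "norm ?J - norm ?R \<le> norm (?J + ?R)" by (rule norm_diff_ineq)
  then show "c * err X z \<le> norm (Psi f A X z T)"
    unfolding eq using J R pos by linarith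
qed

text \<open>A perturbation of size \<open>L e + \<gamma> \<le> c\<close> uses up half of the lower bound \<open>2 c\<close>.\<close>

lemma newton_op_lower:
  assumes e: "err X z < r" and T: "T \<subseteq> active_set A Xs" and g: "0 \<le> \<gamma>" "\<gamma> \<le> c / 2"
  shows "c * norm d \<le> norm (newton_op f A X T \<gamma> d)"
proof -
  note es = err_small[OF e]
  have "norm (hess f X - hess f Xs) \<le> L * err X z"
    using lip[OF es(1,2)] es(4) constants by (smt (verit) mult_left_mono)
  then have "norm (hess f X - hess f Xs) + \<bar>\<gamma>\<bar> \<le> c" using es(3) g by linarith
  then have "norm (newton_op f A X T \<gamma> d - newton_op f A Xs T 0 d) \<le> c * norm d"
    by (intro order_trans[OF newton_op_diff_bound] mult_right_mono) auto
  then show ?thesis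
    using lower[OF T, of d] norm_triangle_ineq2[of "newton_op f A Xs T 0 d" "newton_op f A X T \<gamma> d"]
    by (simp add: norm_minus_commute)
qed

lemma newton_system_ex1:
  assumes e: "err X z < r" and T: "T \<subseteq> active_set A Xs" and g: "0 \<le> \<gamma>" "\<gamma> \<le> c / 2"
  shows "\<exists>!d. newton_system f A X z T \<gamma> d"
proof -
  let ?G = "newton_op f A X T \<gamma>"
  have lin: "linear ?G" by (rule linear_newton_op)
  have inj: "inj ?G"
  proof (subst linear_injective_0[OF lin], intro allI impI)
    fix d assume "?G d = 0"
    then have "c * norm d \<le> 0" using newton_op_lower[OF assms, of d] by simp
    then show "d = 0" using constants by (simp add: mult_le_0_iff)
  qed
  have "surj ?G" by (rule linear_injective_imp_surjective[OF lin inj refl])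
  then have "\<exists>d. ?G d = - Psi f A X z T" by (metis surjD)
  then show ?thesis unfolding newton_system_iff using inj by (metis injD)
qed

text \<open>Applying the Newton operator to the new error cancels \<open>\<Psi>\<close> and leaves the Taylor remainder at
  \<open>X\<close> and the regularisation term \<open>\<gamma> (z - z*)\<close> on \<open>T\<close>. Both are quadratic, since
  \<open>\<gamma> \<le> \<rho> norm \<Psi> \<le> \<rho> C e\<close>.\<close>

lemma newton_step_error:
  assumes e: "err X z < r" and T: "admissible T" and g: "0 \<le> \<gamma>" "\<gamma> \<le> c / 2"
    and g_Psi: "\<gamma> \<le> \<rho> * norm (Psi f A X z T)" and d: "newton_system f A X z T \<gamma> d"
  shows "err (X + fst d) (z + snd d) \<le> (L + 2 * \<rho> * C) / (2 * c) * (err X z)\<^sup>2"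
proof -
  let ?G = "newton_op f A X T \<gamma>" and ?w = "(X, z) - (Xs, zs)"
  have T': "T \<subseteq> active_set A Xs" using T by (simp add: admissible_def)
  have w: "(X + fst d, z + snd d) - (Xs, zs) = ?w + d" by (simp add: prod_eq_iff)
  have J: "newton_op f A X T 0 ?w = Psi f A X z T - (grad f X - grad f Xs - hess_apply f X (X - Xs), 0)"
    using Psi_diff[of f A X z T Xs zs X] T by (simp add: admissible_def)
  have "?G (?w + d) = ?G ?w + ?G d" by (rule linear_add[OF linear_newton_op])
  also have "?G d = - Psi f A X z T" using d by (simp add: newton_system_iff)
  also have "?G ?w + - Psi f A X z T
      = (?G ?w - newton_op f A X T 0 ?w) - (grad f X - grad f Xs - hess_apply f X (X - Xs), 0)"
    unfolding J by simp
  also have "norm \<dots> \<le> \<gamma> * err X z + L / 2 * (err X z)\<^sup>2"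
  proof (rule order_trans[OF norm_triangle_ineq4 add_mono])
    show "norm (?G ?w - newton_op f A X T 0 ?w) \<le> \<gamma> * err X z"
      using newton_op_diff_bound[of f A X T \<gamma> ?w X] g by simp
    show "norm (grad f X - grad f Xs - hess_apply f X (X - Xs), 0 :: real^'n) \<le> L / 2 * (err X z)\<^sup>2"
      using grad_remainder[OF e, of X] by (simp only: norm_Pair norm_zero) simp
  qed
  also have "\<gamma> * err X z \<le> (\<rho> * (C * err X z)) * err X z"
    using Psi_bounds(1)[OF e T] constants
    by (intro mult_right_mono order_trans[OF g_Psi] mult_left_mono) auto
  finally have "norm (?G (?w + d)) \<le> (L + 2 * \<rho> * C) / 2 * (err X z)\<^sup>2"
    by (simp add: power2_eq_square algebra_simps)
  moreover have "c * norm (?w + d) \<le> norm (?G (?w + d))"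
    by (rule newton_op_lower[OF e T' g])
  ultimately have "c * norm (?w + d) \<le> (L + 2 * \<rho> * C) / 2 * (err X z)\<^sup>2" by linarith
  then show ?thesis unfolding w using constants by (simp add: field_simps)
qed

lemma newton_step_contraction:
  assumes e: "err X z < r" and q: "e' \<le> (L + 2 * \<rho> * C) / (2 * c) * (err X z)\<^sup>2"
  shows "e' \<le> err X z / 4"
proof -
  have "(L + 2 * \<rho> * C) / (2 * c) * (err X z)\<^sup>2 = ((L + 2 * \<rho> * C) * err X z) * (err X z / (2 * c))"
    by (simp add: power2_eq_square)
  also have "\<dots> \<le> c / 2 * (err X z / (2 * c))"
    using err_small(5)[OF e] constants by (intro mult_right_mono) auto
  also have "\<dots> = err X z / 4" using constants by simp
  finally show ?thesis using q by (rule order_trans[rotated])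
qed

end

section \<open>Runs of the algorithm\<close>

lemma reg_param_bounds:
  assumes "\<And>k. psi k \<ge> 0" "0 \<le> \<tau>" "\<tau> \<le> 1" "0 \<le> \<rho>" "0 \<le> g" "g \<le> b"
  shows "0 \<le> reg_param \<tau> \<rho> g psi k \<and> reg_param \<tau> \<rho> g psi k \<le> b"
proof (induction k)
  case 0
  have "\<tau> * g \<le> 1 * g" using assms by (intro mult_right_mono)
  then show ?case using assms by auto
next
  case (Suc k)
  have "\<tau> * reg_param \<tau> \<rho> g psi k \<le> 1 * reg_param \<tau> \<rho> g psi k"
    using assms Suc by (intro mult_right_mono) auto
  then show ?case using assms Suc by auto
qed

lemma reg_param_le: "reg_param \<tau> \<rho> g psi k \<le> \<rho> * psi k"
  by (cases k) auto

locale algorithm_region = newton_region f A Xs zs L \<rho> c C r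
  for f :: "real^'p^'m \<Rightarrow> real" and A :: "'n::finite \<Rightarrow> real^'p^'m" and Xs zs L \<rho> c C r +
  fixes \<alpha> lam \<tau> g :: real
  assumes index: "\<And>X z. err X z < r \<Longrightarrow> admissible (index_set \<alpha> lam A X z)"
    and tau: "0 < \<tau>" "\<tau> < 1" and g: "0 \<le> g" "g \<le> c / 2"
begin

definition residual :: "real^'p^'m \<Rightarrow> real^'n \<Rightarrow> real" where
  "residual X z = norm (Psi f A X z (index_set \<alpha> lam A X z))"

lemma Psi_norm_eq: "Psi_norm f lam A \<alpha> X z k = residual (X k) (z k)"
  by (simp add: Psi_norm_def residual_def)

definition step_ok :: "real^'p^'m \<Rightarrow> real^'n \<Rightarrow> real \<Rightarrow> (real^'p^'m) \<times> (real^'n) \<Rightarrow> bool" where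
  "step_ok X z \<gamma> d \<longleftrightarrow>
    (if residual X z > 0 then newton_system f A X z (index_set \<alpha> lam A X z) \<gamma> d else d = 0)"

lemma residual_bounds:
  assumes "err X z < r"
  shows "residual X z \<le> C * err X z" "c * err X z \<le> residual X z"
  using Psi_bounds[OF assms index[OF assms]] by (simp_all add: residual_def)

lemma step_exists:
  assumes "err X z < r" "0 \<le> \<gamma>" "\<gamma> \<le> c / 2"
  shows "\<exists>!d. step_ok X z \<gamma> d"
  using newton_system_ex1[OF assms(1) _ assms(2,3)] index[OF assms(1)]
  unfolding step_ok_def admissible_def by (cases "residual X z > 0") auto

text \<open>When the residual vanishes the iterate already is the solution, since the residual dominates
  the error; so the constant continuation of a stopped run obeys the same estimate.\<close>

lemma step_error:
  assumes e: "err X z < r" and \<gamma>: "0 \<le> \<gamma>" "\<gamma> \<le> c / 2" "\<gamma> \<le> \<rho> * residual X z"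
    and d: "step_ok X z \<gamma> d"
  shows "err (X + fst d) (z + snd d) \<le> (L + 2 * \<rho> * C) / (2 * c) * (err X z)\<^sup>2"
    and "err (X + fst d) (z + snd d) \<le> err X z / 4"
proof -
  show q: "err (X + fst d) (z + snd d) \<le> (L + 2 * \<rho> * C) / (2 * c) * (err X z)\<^sup>2"
  proof (cases "residual X z > 0")
    case True
    then show ?thesis
      using newton_step_error[OF e index[OF e] \<gamma>(1,2)] \<gamma>(3) d by (simp add: step_ok_def residual_def)
  next
    case False
    then have "c * err X z \<le> 0" using residual_bounds(2)[OF e] by linarith
    then have "err X z = 0" using constants by (simp add: mult_le_0_iff)
    moreover have "d = 0" using d False by (simp add: step_ok_def)
    ultimately show ?thesis by simp
  qed
  show "err (X + fst d) (z + snd d) \<le> err X z / 4" by (rule newton_step_contraction[OF e q])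
qed

lemma algorithm_run_iff:
  "algorithm_run f lam A \<alpha> \<rho> \<tau> g X0 z0 X z D \<longleftrightarrow> X 0 = X0 \<and> z 0 = z0 \<and>
    (\<forall>k. step_ok (X k) (z k) (reg_param \<tau> \<rho> g (\<lambda>k. residual (X k) (z k)) k) (D k) \<and>
      X (Suc k) = X k + fst (D k) \<and> z (Suc k) = z k + snd (D k))"
proof -
  have "Psi_norm f lam A \<alpha> X z = (\<lambda>k. residual (X k) (z k))" by (rule ext) (rule Psi_norm_eq)
  then show ?thesis
    unfolding algorithm_run_def step_ok_def newton_step_at_def by (simp only:)
qed

lemma reg_param_run_bounds:
  "0 \<le> reg_param \<tau> \<rho> g (\<lambda>k. residual (X k) (z k)) k"
  "reg_param \<tau> \<rho> g (\<lambda>k. residual (X k) (z k)) k \<le> c / 2"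
  using reg_param_bounds[of "\<lambda>k. residual (X k) (z k)" \<tau> \<rho> g "c / 2" k] tau g constants
  by (simp_all add: residual_def)

text \<open>The regularisation parameter depends on the whole past of the run, so it is carried along as a
  component of the state of the recursion.\<close>

lemma run_exists:
  assumes "err X0 z0 < r"
  shows "\<exists>X z D. algorithm_run f lam A \<alpha> \<rho> \<tau> g X0 z0 X z D"
proof -
  define reg where "reg s = min (\<tau> * snd s) (\<rho> * residual (fst (fst s)) (snd (fst s)))"
    for s :: "((real^'p^'m) \<times> (real^'n)) \<times> real"
  define dir where "dir s = (SOME d. step_ok (fst (fst s)) (snd (fst s)) (reg s) d)"
    for s :: "((real^'p^'m) \<times> (real^'n)) \<times> real"
  define S where "S = rec_nat ((X0, z0), g) (\<lambda>_ s. (fst s + dir s, reg s))"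
  have S_0: "S 0 = ((X0, z0), g)" and S_Suc: "S (Suc k) = (fst (S k) + dir (S k), reg (S k))" for k
    by (simp_all add: S_def)
  define X where "X k = fst (fst (S k))" for k
  define z where "z k = snd (fst (S k))" for k
  have reg_ok: "0 \<le> reg s \<and> reg s \<le> c / 2 \<and> reg s \<le> \<rho> * residual (fst (fst s)) (snd (fst s))"
    if "0 \<le> snd s" "snd s \<le> c / 2" for s
  proof -
    have "\<tau> * snd s \<le> 1 * snd s" using that tau by (intro mult_right_mono) auto
    then show ?thesis unfolding reg_def using that tau constants by (auto simp: residual_def)
  qed
  have dir_ok: "step_ok (fst (fst s)) (snd (fst s)) (reg s) (dir s)"
    if "err (fst (fst s)) (snd (fst s)) < r" "0 \<le> snd s" "snd s \<le> c / 2" for s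
    unfolding dir_def using step_exists[OF that(1)] reg_ok[OF that(2,3)] by (metis someI_ex)
  have inv: "err (X k) (z k) < r \<and> 0 \<le> snd (S k) \<and> snd (S k) \<le> c / 2" for k
  proof (induction k)
    case 0 then show ?case using assms g by (simp add: X_def z_def S_0)
  next
    case (Suc k)
    then have "err (X k + fst (dir (S k))) (z k + snd (dir (S k))) \<le> err (X k) (z k) / 4"
      using dir_ok[of "S k"] reg_ok[of "S k"] unfolding X_def z_def by (intro step_error) auto
    moreover have "err (X k) (z k) / 4 \<le> err (X k) (z k)" by simp
    ultimately have "err (X (Suc k)) (z (Suc k)) < r"
      using Suc unfolding X_def z_def S_Suc fst_conv fst_add snd_add by linarith
    then show ?case using reg_ok[of "S k"] Suc by (simp add: S_Suc)
  qed
  have "reg_param \<tau> \<rho> g (\<lambda>k. residual (X k) (z k)) k = reg (S k)" for k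
  proof (induction k)
    case 0 then show ?case by (simp add: reg_def X_def z_def S_0)
  next
    case (Suc k)
    have "snd (S (Suc k)) = reg (S k)" by (simp add: S_Suc)
    with Suc show ?case unfolding reg_param.simps reg_def[of "S (Suc k)"] by (simp add: X_def z_def)
  qed
  then have "algorithm_run f lam A \<alpha> \<rho> \<tau> g X0 z0 X z (\<lambda>k. dir (S k))"
    unfolding algorithm_run_iff using dir_ok inv by (simp add: X_def z_def S_0 S_Suc)
  then show ?thesis by blast
qed

lemma run_error:
  assumes run: "algorithm_run f lam A \<alpha> \<rho> \<tau> g X0 z0 X z D" and e: "err X0 z0 < r"
  shows "err (X k) (z k) < r"
    and "err (X (Suc k)) (z (Suc k)) \<le> (L + 2 * \<rho> * C) / (2 * c) * (err (X k) (z k))\<^sup>2"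
    and "err (X k) (z k) \<le> err X0 z0 / 4 ^ k"
proof -
  let ?\<gamma> = "reg_param \<tau> \<rho> g (\<lambda>k. residual (X k) (z k))"
  have start: "X 0 = X0" "z 0 = z0"
    and step: "\<And>k. step_ok (X k) (z k) (?\<gamma> k) (D k)"
    and nxt: "\<And>k. X (Suc k) = X k + fst (D k)" "\<And>k. z (Suc k) = z k + snd (D k)"
    using run unfolding algorithm_run_iff by auto
  have se: "err (X (Suc k)) (z (Suc k)) \<le> (L + 2 * \<rho> * C) / (2 * c) * (err (X k) (z k))\<^sup>2"
    "err (X (Suc k)) (z (Suc k)) \<le> err (X k) (z k) / 4" if "err (X k) (z k) < r" for k
    using step_error[OF that reg_param_run_bounds reg_param_le step] unfolding nxt by blast+
  show r: "err (X k) (z k) < r" for k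
  proof (induction k)
    case 0 then show ?case using e start by simp
  next
    case (Suc k)
    have "err (X k) (z k) / 4 \<le> err (X k) (z k)" by simp
    then show ?case using se(2)[OF Suc] Suc by linarith
  qed
  show "err (X (Suc k)) (z (Suc k)) \<le> (L + 2 * \<rho> * C) / (2 * c) * (err (X k) (z k))\<^sup>2"
    by (rule se(1)[OF r])
  show "err (X k) (z k) \<le> err X0 z0 / 4 ^ k"
  proof (induction k)
    case 0 then show ?case using start by simp
  next
    case (Suc k)
    have "err (X (Suc k)) (z (Suc k)) \<le> err (X k) (z k) / 4" by (rule se(2)[OF r])
    also have "\<dots> \<le> err X0 z0 / 4 ^ k / 4" using Suc by (rule divide_right_mono) simp
    finally show ?case by (simp add: mult.commute)
  qed
qed

lemma run_newton_step_unique: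
  assumes run: "algorithm_run f lam A \<alpha> \<rho> \<tau> g X0 z0 X z D" and e: "err X0 z0 < r"
    and pos: "Psi_norm f lam A \<alpha> X z k > 0"
  shows "\<exists>!d. newton_step_at f lam A \<alpha> \<rho> \<tau> g X z k d"
proof -
  have eq: "Psi_norm f lam A \<alpha> X z = (\<lambda>k. residual (X k) (z k))" by (rule ext) (rule Psi_norm_eq)
  show ?thesis
    using step_exists[OF run_error(1)[OF run e, of k] reg_param_run_bounds[of X z k]] pos
    unfolding newton_step_at_def eq step_ok_def by simp
qed

lemma run_converges:
  assumes run: "algorithm_run f lam A \<alpha> \<rho> \<tau> g X0 z0 X z D" and e: "err X0 z0 < r"
  shows "(\<lambda>k. (X k, z k)) \<longlonglongrightarrow> (Xs, zs)" and "D \<longlonglongrightarrow> 0"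
proof -
  have "(\<lambda>k. err X0 z0 * (1 / 4) ^ k) \<longlonglongrightarrow> err X0 z0 * 0"
    by (intro tendsto_mult tendsto_const LIMSEQ_power_zero) simp
  then have "(\<lambda>k. err X0 z0 * (1 / 4) ^ k) \<longlonglongrightarrow> 0" by simp
  then have "(\<lambda>k. (X k, z k) - (Xs, zs)) \<longlonglongrightarrow> 0"
    by (rule Lim_null_comparison[rotated])
      (intro always_eventually allI, rule order_trans[OF run_error(3)[OF run e]], simp only: power_one_over, simp)
  then show lim: "(\<lambda>k. (X k, z k)) \<longlonglongrightarrow> (Xs, zs)" by (simp only: LIM_zero_iff)
  then have "(\<lambda>k. (X (Suc k), z (Suc k)) - (X k, z k)) \<longlonglongrightarrow> (Xs, zs) - (Xs, zs)"
    by (intro tendsto_diff LIMSEQ_Suc)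
  moreover have "(\<lambda>k. (X (Suc k), z (Suc k)) - (X k, z k)) = D"
    using run by (auto simp: algorithm_run_def prod_eq_iff)
  ultimately show "D \<longlonglongrightarrow> 0" by simp
qed

text \<open>The sum of the two norms is at most twice the norm of the pair, which absorbs the factor 1/2 of
  the error estimate.\<close>

lemma run_quadratic:
  assumes run: "algorithm_run f lam A \<alpha> \<rho> \<tau> g X0 z0 X z D" and e: "err X0 z0 < r"
  shows "norm (X (Suc k) - Xs) + norm (z (Suc k) - zs)
    \<le> (L + 2 * \<rho> * C) / c * ((norm (X k - Xs))\<^sup>2 + (norm (z k - zs))\<^sup>2)"
proof -
  have "norm (X (Suc k) - Xs) + norm (z (Suc k) - zs) \<le> 2 * err (X (Suc k)) (z (Suc k))"
    using norm_fst_le[of "X (Suc k) - Xs" "z (Suc k) - zs"]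
      norm_snd_le[of "z (Suc k) - zs" "X (Suc k) - Xs"] by simp
  also have "\<dots> \<le> 2 * ((L + 2 * \<rho> * C) / (2 * c) * (err (X k) (z k))\<^sup>2)"
    using run_error(2)[OF run e, of k] by (rule mult_left_mono) simp
  also have "\<dots> = (L + 2 * \<rho> * C) / c * ((norm (X k - Xs))\<^sup>2 + (norm (z k - zs))\<^sup>2)"
    by (simp add: norm_pair_sq del: norm_Pair)
  finally show ?thesis .
qed

lemma run_residual_quadratic:
  assumes run: "algorithm_run f lam A \<alpha> \<rho> \<tau> g X0 z0 X z D" and e: "err X0 z0 < r"
  shows "Psi_norm f lam A \<alpha> X z (Suc k)
    \<le> C * (L + 2 * \<rho> * C) / c ^ 3 * (Psi_norm f lam A \<alpha> X z k)\<^sup>2"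
proof -
  let ?K = "L + 2 * \<rho> * C" and ?R = "residual (X k) (z k)"
  have "c * err (X k) (z k) \<le> ?R" by (rule residual_bounds(2)[OF run_error(1)[OF run e]])
  then have "(c * err (X k) (z k))\<^sup>2 \<le> ?R\<^sup>2" using constants by (intro power_mono) auto
  then have sq: "(err (X k) (z k))\<^sup>2 \<le> ?R\<^sup>2 / c\<^sup>2"
    using constants by (simp only: pos_le_divide_eq zero_less_power power_mult_distrib mult.commute)
  have "residual (X (Suc k)) (z (Suc k)) \<le> C * err (X (Suc k)) (z (Suc k))"
    by (rule residual_bounds(1)[OF run_error(1)[OF run e]])
  also have "\<dots> \<le> C * (?K / (2 * c) * (err (X k) (z k))\<^sup>2)"
    using run_error(2)[OF run e] constants by (intro mult_left_mono) auto
  also have "\<dots> \<le> C * (?K / (2 * c) * (?R\<^sup>2 / c\<^sup>2))"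
    using sq constants K_pos by (intro mult_left_mono) auto
  also have "\<dots> \<le> 2 * (C * (?K / (2 * c) * (?R\<^sup>2 / c\<^sup>2)))"
  proof -
    have "0 \<le> C * (?K / (2 * c) * (?R\<^sup>2 / c\<^sup>2))"
      using constants K_pos by (intro mult_nonneg_nonneg divide_nonneg_nonneg) auto
    then show ?thesis by linarith
  qed
  also have "\<dots> = C * ?K / c ^ 3 * ?R\<^sup>2"
    by (simp add: power2_eq_square power3_eq_cube)
  finally show ?thesis unfolding Psi_norm_eq .
qed

text \<open>The threshold for \<open>k\<close> says \<open>Q s\<^sup>2 \<le> 4^(k-1) \<epsilon>\<close> with \<open>Q = K C\<^sup>3 / c\<^sup>3\<close> and \<open>s\<close> the initial
  distance. One quadratic step after \<open>k - 1\<close> contractions by 1/4 bounds the residual by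
  \<open>C K / (2 c) s\<^sup>2 / 16^(k-1)\<close>, and \<open>C / (2 c) < C\<^sup>3 / c\<^sup>3\<close> because \<open>c \<le> C\<close>.\<close>

lemma run_iteration_bound:
  assumes run: "algorithm_run f lam A \<alpha> \<rho> \<tau> g X0 z0 X z D" and e: "err X0 z0 < r"
    and eps: "\<epsilon> > 0" and k: "k \<ge> 1"
    and bound: "(X0, z0) = (Xs, zs) \<or>
      real k \<ge> log 2 (2 * sqrt ((L + 2 * \<rho> * C) * C ^ 3 / c ^ 3)
                        * (norm (X0 - Xs) + norm (z0 - zs))) - log 2 (sqrt \<epsilon>)"
  shows "Psi_norm f lam A \<alpha> X z k < \<epsilon>"
proof (cases "(X0, z0) = (Xs, zs)")
  case True
  then have "err (X k) (z k) \<le> 0" using run_error(3)[OF run e, of k] by simp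
  moreover have "residual (X k) (z k) \<le> C * err (X k) (z k)"
    by (rule residual_bounds(1)[OF run_error(1)[OF run e]])
  moreover have "C * err (X k) (z k) \<le> 0" using calculation(1) constants by (simp add: mult_le_0_iff)
  ultimately show ?thesis unfolding Psi_norm_eq using eps by linarith
next
  case False
  let ?K = "L + 2 * \<rho> * C"
  define Q where "Q = ?K * C ^ 3 / c ^ 3"
  define s where "s = norm (X0 - Xs) + norm (z0 - zs)"
  obtain j where j: "k = Suc j" using k by (cases k) auto
  have Q: "Q > 0" unfolding Q_def using K_pos constants by simp
  have s: "s > 0" unfolding s_def using False
    by (metis add_nonneg_eq_0_iff add_nonneg_nonneg eq_iff_diff_eq_0 less_eq_real_def norm_eq_zero norm_ge_zero)
  have es: "err X0 z0 \<le> s" unfolding s_def by (simp add: norm_Pair) (metis norm_Pair norm_Pair_le)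
  have "real k \<ge> log 2 (2 * sqrt Q * s) - log 2 (sqrt \<epsilon>)"
    using bound False unfolding Q_def s_def by blast
  also have "log 2 (2 * sqrt Q * s) - log 2 (sqrt \<epsilon>) = log 2 (2 * sqrt Q * s / sqrt \<epsilon>)"
    using Q s eps by (simp add: log_divide)
  finally have "2 * sqrt Q * s / sqrt \<epsilon> \<le> 2 powr real k"
    using Q s eps by (subst (asm) log_le_iff) auto
  then have "2 * sqrt Q * s \<le> 2 ^ k * sqrt \<epsilon>"
    using eps by (simp add: powr_realpow pos_divide_le_eq)
  then have "(2 * sqrt Q * s)\<^sup>2 \<le> (2 ^ k * sqrt \<epsilon>)\<^sup>2"
    using Q s by (intro power_mono) auto
  then have "4 * Q * s\<^sup>2 \<le> (2 ^ k)\<^sup>2 * \<epsilon>"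
    using Q eps by (simp add: power_mult_distrib)
  also have "(2 ^ k)\<^sup>2 = 4 * (4::real) ^ j"
    by (simp add: j power_mult_distrib power2_eq_square flip: power_mult_distrib)
  finally have thr: "Q * s\<^sup>2 \<le> 4 ^ j * \<epsilon>" by simp
  have "1 \<le> C / c" using constants by simp
  then have "(C / c) ^ 1 \<le> (C / c) ^ 3" by (intro power_increasing) auto
  moreover have "C / (2 * c) < C / c" using constants by (simp add: field_simps)
  ultimately have "C / (2 * c) < C ^ 3 / c ^ 3" by (simp add: power_divide)
  then have coef: "?K * (C / (2 * c)) < Q"
    unfolding Q_def using K_pos by (simp only: times_divide_eq_right[symmetric] mult_strict_left_mono)
  have "err (X j) (z j) \<le> s / 4 ^ j"
    using run_error(3)[OF run e, of j] es by (meson divide_right_mono order_trans zero_le_numeral zero_le_power)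
  then have "(err (X j) (z j))\<^sup>2 \<le> (s / 4 ^ j)\<^sup>2" by (intro power_mono) auto
  also have "\<dots> = s\<^sup>2 / (4 ^ j * 4 ^ j)" by (simp add: power2_eq_square)
  also have "\<dots> \<le> s\<^sup>2 / (4 ^ j * 1)" by (intro divide_left_mono mult_left_mono) auto
  finally have ej: "(err (X j) (z j))\<^sup>2 \<le> s\<^sup>2 / 4 ^ j" by simp
  have "residual (X k) (z k) \<le> C * err (X k) (z k)"
    by (rule residual_bounds(1)[OF run_error(1)[OF run e]])
  also have "\<dots> \<le> C * (?K / (2 * c) * (err (X j) (z j))\<^sup>2)"
    unfolding j using run_error(2)[OF run e] constants by (intro mult_left_mono) auto
  also have "\<dots> = (?K * (C / (2 * c))) * (err (X j) (z j))\<^sup>2" by simp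
  also have "\<dots> \<le> (?K * (C / (2 * c))) * (s\<^sup>2 / 4 ^ j)"
    using ej K_pos constants by (intro mult_left_mono) auto
  also have "\<dots> < Q * (s\<^sup>2 / 4 ^ j)" using coef s by (intro mult_strict_right_mono) auto
  also have "\<dots> \<le> \<epsilon>" using thr by (simp add: pos_divide_le_eq mult.commute)
  finally show ?thesis unfolding Psi_norm_eq .
qed

end

section \<open>Quadratic convergence\<close>

theorem mainTheorem6:
  fixes f :: "real^'p^'m \<Rightarrow> real"
    and A :: "'n::finite \<Rightarrow> real^'p^'m"
    and Xs X0 :: "real^'p^'m"
    and zs z0 :: "real^'n"
    and \<alpha> lam \<rho> \<tau> \<gamma>m1 L \<delta>0 \<delta>1 \<delta>2 \<delta>s c C :: real
  assumes f_C2: "twice_cont_diff f"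
    and params: "lam > 0" "\<alpha> > 0" "\<rho> > 0" "0 < \<tau>" "\<tau> < 1"
    and stat: "P_stationary f lam A \<alpha> Xs zs"
    and alpha_small: "ereal \<alpha> < alpha_star lam A Xs zs"
    and lin_indep: "inj_on A (active_set A Xs)" "independent (A ` active_set A Xs)"
    and L_pos: "L > 0" and \<delta>0_pos: "\<delta>0 > 0"
    and hess_Lipschitz:
      "\<And>X1 X2. X1 \<in> ball Xs \<delta>0 \<Longrightarrow> X2 \<in> ball Xs \<delta>0 \<Longrightarrow>
         norm (hess f X1 - hess f X2) \<le> L * norm (X1 - X2)"
    and sosc: "second_order_sufficient f lam A Xs"
    and C_eq: "C = C_star f A Xs"
    and c_eq: "c = c_star f A Xs"
    and \<delta>1_pos: "\<delta>1 > 0"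
    and \<delta>1_radius:
      "\<And>X z. (X, z) \<in> ball (Xs, zs) \<delta>1 \<Longrightarrow>
         Psi f A Xs zs (index_set \<alpha> lam A X z) = 0 \<and>
         index_set \<alpha> lam A X z \<subseteq> active_set A Xs"
    and \<delta>2_eq: "\<delta>2 = min \<delta>1 (c / (2 * L))"
    and \<delta>s_eq: "\<delta>s = min \<delta>2 (c / (2 * (L + 2 * \<rho> * C)))"
    and \<delta>s_le: "\<delta>s \<le> \<delta>0"
    and \<gamma>m1: "0 \<le> \<gamma>m1" "\<gamma>m1 \<le> c / 2"
    and init: "(X0, z0) \<in> ball (Xs, zs) \<delta>s"
  shows
    "(\<exists>X z D. algorithm_run f lam A \<alpha> \<rho> \<tau> \<gamma>m1 X0 z0 X z D) \<and>
     (\<forall>X z D. algorithm_run f lam A \<alpha> \<rho> \<tau> \<gamma>m1 X0 z0 X z D \<longrightarrow>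
        (\<forall>k. Psi_norm f lam A \<alpha> X z k > 0 \<longrightarrow>
             (\<exists>!d. newton_step_at f lam A \<alpha> \<rho> \<tau> \<gamma>m1 X z k d)) \<and>
        D \<longlonglongrightarrow> 0 \<and>
        (\<lambda>k. (X k, z k)) \<longlonglongrightarrow> (Xs, zs) \<and>
        (\<forall>k. norm (X (Suc k) - Xs) + norm (z (Suc k) - zs)
               \<le> (L + 2 * \<rho> * C) / c * ((norm (X k - Xs))\<^sup>2 + (norm (z k - zs))\<^sup>2)) \<and>
        (\<forall>k. Psi_norm f lam A \<alpha> X z (Suc k)
               \<le> C * (L + 2 * \<rho> * C) / c ^ 3 * (Psi_norm f lam A \<alpha> X z k)\<^sup>2) \<and>
        (\<forall>\<epsilon>>0. \<forall>k\<ge>1.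
           (X0, z0) = (Xs, zs) \<or>
           real k \<ge> log 2 (2 * sqrt ((L + 2 * \<rho> * C) * C ^ 3 / c ^ 3)
                             * (norm (X0 - Xs) + norm (z0 - zs))) - log 2 (sqrt \<epsilon>)
           \<longrightarrow> Psi_norm f lam A \<alpha> X z k < \<epsilon>))"
proof -
  have C: "C \<ge> 2" by (simp add: C_eq C_star_def)
  have e0: "norm ((X0, z0) - (Xs, zs)) < \<delta>s"
    using init unfolding mem_ball by (metis dist_commute dist_norm)
  \<comment> \<open>Some point lies in the initial ball, so its radius is positive, and the radius is at most
    \<open>c / (2 * L)\<close>.\<close>
  then have "0 < \<delta>s" by (rule le_less_trans[OF norm_ge_zero])
  then have "0 < c / (2 * L)" using \<delta>s_eq \<delta>2_eq by simp
  then have c: "c > 0" using L_pos by (simp add: zero_less_divide_iff)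
  have c2: "c \<le> 1 / 2" by (simp add: c_eq c_star_def)
  interpret newton_region f A Xs zs L \<rho> c C \<delta>s
  proof
    show "norm (hess f U - hess f V) \<le> L * norm (U - V)" if "U \<in> ball Xs \<delta>s" "V \<in> ball Xs \<delta>s" for U V
      using that \<delta>s_le by (intro hess_Lipschitz) auto
    show "2 * c * norm v \<le> norm (newton_op f A Xs T 0 v)" if "T \<subseteq> active_set A Xs" for T v
      using newton_op_lower_bound[OF that] c by (simp add: c_eq)
    show "norm (newton_op f A Xs T 0 v) \<le> C / 2 * norm v" if "T \<subseteq> active_set A Xs" for T v
      using newton_op_upper_bound[OF that] by (simp add: C_eq)
    show "\<delta>s \<le> c / (2 * L)" using \<delta>s_eq \<delta>2_eq by linarith
    show "\<delta>s \<le> c / (2 * (L + 2 * \<rho> * C))" using \<delta>s_eq by linarith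
  qed (fact f_C2 L_pos params c c2 C)+
  interpret algorithm_region f A Xs zs L \<rho> c C \<delta>s \<alpha> lam \<tau> \<gamma>m1
  proof
    show "admissible (index_set \<alpha> lam A X z)" if "err X z < \<delta>s" for X z
    proof -
      have "dist (Xs, zs) (X, z) = err X z" by (subst dist_commute) (rule dist_norm)
      then have "(X, z) \<in> ball (Xs, zs) \<delta>1"
        unfolding mem_ball using that \<delta>s_eq \<delta>2_eq by linarith
      then show ?thesis using \<delta>1_radius by (simp add: admissible_def)
    qed
  qed (fact params \<gamma>m1)+
  show ?thesis
  proof (intro conjI allI impI)
    show "\<exists>X z D. algorithm_run f lam A \<alpha> \<rho> \<tau> \<gamma>m1 X0 z0 X z D" by (rule run_exists[OF e0])
  next
    fix X z D assume run: "algorithm_run f lam A \<alpha> \<rho> \<tau> \<gamma>m1 X0 z0 X z D"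
    note facts = run_newton_step_unique[OF run e0] run_converges[OF run e0] run_quadratic[OF run e0]
      run_residual_quadratic[OF run e0]
    show "\<exists>!d. newton_step_at f lam A \<alpha> \<rho> \<tau> \<gamma>m1 X z k d" if "Psi_norm f lam A \<alpha> X z k > 0" for k
      by (rule facts(1)[OF that])
    show "D \<longlonglongrightarrow> 0" by (rule facts)
    show "(\<lambda>k. (X k, z k)) \<longlonglongrightarrow> (Xs, zs)" by (rule facts)
    show "norm (X (Suc k) - Xs) + norm (z (Suc k) - zs)
        \<le> (L + 2 * \<rho> * C) / c * ((norm (X k - Xs))\<^sup>2 + (norm (z k - zs))\<^sup>2)" for k
      by (rule facts)
    show "Psi_norm f lam A \<alpha> X z (Suc k)
        \<le> C * (L + 2 * \<rho> * C) / c ^ 3 * (Psi_norm f lam A \<alpha> X z k)\<^sup>2" for k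
      by (rule facts)
    show "Psi_norm f lam A \<alpha> X z k < \<epsilon>"
      if "\<epsilon> > 0" "k \<ge> 1"
        "(X0, z0) = (Xs, zs) \<or>
         real k \<ge> log 2 (2 * sqrt ((L + 2 * \<rho> * C) * C ^ 3 / c ^ 3)
                           * (norm (X0 - Xs) + norm (z0 - zs))) - log 2 (sqrt \<epsilon>)" for \<epsilon> k
      by (rule run_iteration_bound[OF run e0 that])
  qed
qed

end
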